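(* Let $A,B,C,D$ be parameters (indeterminates) and let $x_1,\dots,x_6$ be independent indeterminates (initial values). Define $x_7,x_8,\ldots$ recursively as rational functions by solving, for $n=1,2,3,\dots$, $$\big(A x_{n+1}x_{n+5}+(B+C)x_{n+2}x_{n+4}\big)x_{n+3}+D\big(x_nx_{n+4}x_{n+5}+x_{n+1}x_{n+2}x_{n+6}\big)=0$$ for $x_{n+6}$; that is, consider the iterates of the mapping $(x_1,x_2,x_3,x_4,x_5,x_6)\mapsto(x_2,x_3,x_4,x_5,x_6,x_7)$. Then this mapping has the Laurent property: for every $n\ge 1$, $x_n$ is a Laurent polynomial in the initial values $x_1,\dots,x_6$, with coefficients in $\mathbb{Z}[A,B,C,D,D^{-1}]$.
   Context: A map defined by a rational recurrence has the Laurent property if, for all $n$, the denominator of the $n$-th iterate (in lowest terms) is a product of powers of the initial values (a monomial in the initial values, up to constants of the coefficient ring), i.e. all iterates are Laurent polynomials in the initial values. The recurrence above is the $(2,1)$-periodic reduction of the trilinear Boussinesq lattice equation; since $C$ and $D$ can be absorbed into $A$ and $B$, one may normalise $C=0$, $D=1$, in which case the coefficients lie in $\mathbb{Z}[A,B]$. *)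

theory Defs
  imports
    "HOL-Library.Poly_Mapping"
    "HOL-Computational_Algebra.Fraction_Field"
    "HOL-Number_Theory.Cong"
begin

section \<open>The ambient field of rational functions\<close>

datatype indet = IndA | IndB | IndC | IndD | X1 | X2 | X3 | X4 | X5 | X6

text \<open>
  The order on the ten indeterminates is arbitrary. It is only needed because
  \<^typ>\<open>(indet \<Rightarrow>\<^sub>0 nat) \<Rightarrow>\<^sub>0 int\<close> is known to be an integral domain for linearly ordered
  indeterminates.
\<close>

instantiation indet :: linorder
begin

primrec rank_indet :: "indet \<Rightarrow> nat" where
  "rank_indet IndA = 0"
| "rank_indet IndB = 1"
| "rank_indet IndC = 2"
| "rank_indet IndD = 3"
| "rank_indet X1 = 4"
| "rank_indet X2 = 5"
| "rank_indet X3 = 6"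
| "rank_indet X4 = 7"
| "rank_indet X5 = 8"
| "rank_indet X6 = 9"

definition less_eq_indet :: "indet \<Rightarrow> indet \<Rightarrow> bool" where
  "less_eq_indet u v \<longleftrightarrow> rank_indet u \<le> rank_indet v"

definition less_indet :: "indet \<Rightarrow> indet \<Rightarrow> bool" where
  "less_indet u v \<longleftrightarrow> rank_indet u < rank_indet v"

instance
proof
  fix u v :: indet
  show "u = v" if "u \<le> v" "v \<le> u"
    using that by (cases u; cases v) (simp_all add: less_eq_indet_def)
qed (auto simp: less_eq_indet_def less_indet_def)

end

type_synonym int_mpoly = "(indet \<Rightarrow>\<^sub>0 nat) \<Rightarrow>\<^sub>0 int"
type_synonym ratfun = "int_mpoly fract"

definition mvar :: "indet \<Rightarrow> int_mpoly" where
  "mvar v = Poly_Mapping.single (Poly_Mapping.single v 1) 1"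

definition rvar :: "indet \<Rightarrow> ratfun" where
  "rvar v = Fract (mvar v) 1"

definition parA :: ratfun where "parA = rvar IndA"
definition parB :: ratfun where "parB = rvar IndB"
definition parC :: ratfun where "parC = rvar IndC"
definition parD :: ratfun where "parD = rvar IndD"

text \<open>Only the values at \<open>i = 1, \<dots>, 6\<close> are meaningful.\<close>

definition init_val :: "nat \<Rightarrow> ratfun" where
  "init_val i = rvar ([X1, X2, X3, X4, X5, X6] ! (i - 1))"


section \<open>The iterates\<close>

text \<open>
  Indexing starts at 1; the value at 0 is irrelevant. The defining equation is the recurrence
  solved for its term of highest index. The division is genuine: see
  \<open>iterate_nonzero\<close>, \<open>iterate_recurrence\<close> and \<open>iterate_unique\<close> below.
\<close>

fun iterate :: "nat \<Rightarrow> ratfun" where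
  "iterate n =
    (if n \<le> 6 then init_val n
     else - ((parA * iterate (n - 5) * iterate (n - 1)
                + (parB + parC) * iterate (n - 4) * iterate (n - 2)) * iterate (n - 3)
              + parD * (iterate (n - 6) * iterate (n - 2) * iterate (n - 1)))
          / (parD * iterate (n - 5) * iterate (n - 4)))"

declare iterate.simps [simp del]


section \<open>Laurent polynomials\<close>

text \<open>The subring generated by \<open>S\<close>.\<close>

inductive_set ring_adjoin :: "'a::comm_ring_1 set \<Rightarrow> 'a set" for S where
  one: "1 \<in> ring_adjoin S"
| gen: "s \<in> S \<Longrightarrow> s \<in> ring_adjoin S"
| diff: "a \<in> ring_adjoin S \<Longrightarrow> b \<in> ring_adjoin S \<Longrightarrow> a - b \<in> ring_adjoin S"
| mult: "a \<in> ring_adjoin S \<Longrightarrow> b \<in> ring_adjoin S \<Longrightarrow> a * b \<in> ring_adjoin S"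

definition coeff_ring :: "ratfun set" where
  "coeff_ring = ring_adjoin {parA, parB, parC, parD, inverse parD}"

definition laurent_polynomial :: "ratfun \<Rightarrow> bool" where
  "laurent_polynomial f \<longleftrightarrow>
    (\<exists>(E :: (nat \<Rightarrow> int) set) c.
        finite E \<and> (\<forall>e\<in>E. c e \<in> coeff_ring) \<and>
        f = (\<Sum>e\<in>E. c e * (\<Prod>i=1..6. init_val i powi e i)))"


section \<open>The iterates are well defined\<close>

text \<open>
  Setting all indeterminates to 1 and reducing modulo 5 turns the recurrence into one
  with the constant solution 1, so no iterate vanishes.
\<close>

definition coeff_sum :: "int_mpoly \<Rightarrow> int" where
  "coeff_sum p = (\<Sum>m\<in>Poly_Mapping.keys p. Poly_Mapping.lookup p m)"

lemma coeff_sum_superset: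
  assumes "finite M" "Poly_Mapping.keys p \<subseteq> M"
  shows "coeff_sum p = (\<Sum>m\<in>M. Poly_Mapping.lookup p m)"
  unfolding coeff_sum_def
  by (rule sum.mono_neutral_left) (use assms in \<open>auto simp: in_keys_iff\<close>)

lemma coeff_sum_zero [simp]: "coeff_sum 0 = 0"
  by (simp add: coeff_sum_def)

lemma coeff_sum_single [simp]: "coeff_sum (Poly_Mapping.single m c) = c"
  by (subst coeff_sum_superset[of "{m}"]) auto

lemma coeff_sum_one [simp]: "coeff_sum 1 = 1"
  using coeff_sum_single[of 0 1] by simp

lemma coeff_sum_mvar [simp]: "coeff_sum (mvar v) = 1"
  by (simp add: mvar_def)

lemma coeff_sum_add [simp]: "coeff_sum (p + q) = coeff_sum p + coeff_sum q"
proof -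
  let ?M = "Poly_Mapping.keys p \<union> Poly_Mapping.keys q"
  have "coeff_sum (p + q) = (\<Sum>m\<in>?M. Poly_Mapping.lookup (p + q) m)"
    by (rule coeff_sum_superset) (auto simp: Poly_Mapping.keys_add)
  also have "\<dots> = coeff_sum p + coeff_sum q"
    by (simp add: lookup_add sum.distrib coeff_sum_superset[of ?M])
  finally show ?thesis .
qed

lemma coeff_sum_uminus [simp]: "coeff_sum (- p) = - coeff_sum p"
  using coeff_sum_add[of p "- p"] by simp

lemma mpoly_induct:
  fixes p :: int_mpoly
  assumes "P 0" "\<And>m c p. P p \<Longrightarrow> P (Poly_Mapping.single m c + p)"
  shows "P p"
proof (induction p rule: update_induct)
  case const
  show ?case by (rule assms(1))
next
  case (update f a b)
  have "Poly_Mapping.update a b f = Poly_Mapping.single a b + f"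
    using update by (intro poly_mapping_eqI)
      (auto simp: lookup_add lookup_update lookup_single when_def in_keys_iff)
  then show ?case using assms(2) update by simp
qed

lemma coeff_sum_mult [simp]: "coeff_sum (p * q) = coeff_sum p * coeff_sum q"
proof (induction p rule: mpoly_induct)
  case 1
  show ?case by simp
next
  case (2 m c p)
  have "coeff_sum (Poly_Mapping.single m c * q) = c * coeff_sum q"
  proof (induction q rule: mpoly_induct)
    case 1
    show ?case by simp
  next
    case (2 m' c' q)
    then show ?case by (simp only: distrib_left mult_single coeff_sum_add coeff_sum_single)
  qed
  with 2 show ?case by (simp only: distrib_right coeff_sum_add coeff_sum_single)
qed

definition reduces_to :: "ratfun \<Rightarrow> int \<Rightarrow> bool" where
  "reduces_to f r \<longleftrightarrow>
    (\<exists>p q. f = Fract p q \<and> \<not> 5 dvd coeff_sum q \<and> [coeff_sum p = r * coeff_sum q] (mod 5))"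

lemma prime_dvd_5: "5 dvd a * b \<longleftrightarrow> 5 dvd a \<or> 5 dvd (b::int)"
  by (rule prime_dvd_mult_iff) simp

lemma coeff_sum_nonzero: "\<not> 5 dvd coeff_sum q \<Longrightarrow> q \<noteq> 0"
  by auto

lemma reduces_to_rvar: "reduces_to (rvar v) 1"
  unfolding reduces_to_def rvar_def by (intro exI[of _ "mvar v"] exI[of _ 1]) auto

lemma reduces_to_mult:
  assumes "reduces_to f r" "reduces_to g s"
  shows "reduces_to (f * g) (r * s)"
proof -
  from assms obtain p q p' q' where *:
    "f = Fract p q" "\<not> 5 dvd coeff_sum q" "[coeff_sum p = r * coeff_sum q] (mod 5)"
    "g = Fract p' q'" "\<not> 5 dvd coeff_sum q'" "[coeff_sum p' = s * coeff_sum q'] (mod 5)"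
    unfolding reduces_to_def by blast
  have "[coeff_sum p * coeff_sum p' = r * s * (coeff_sum q * coeff_sum q')] (mod 5)"
    using cong_mult[OF *(3,6)] by (simp add: ac_simps)
  with * show ?thesis unfolding reduces_to_def
    by (intro exI[of _ "p * p'"] exI[of _ "q * q'"]) (auto simp: prime_dvd_5)
qed

lemma reduces_to_add:
  assumes "reduces_to f r" "reduces_to g s"
  shows "reduces_to (f + g) (r + s)"
proof -
  from assms obtain p q p' q' where *:
    "f = Fract p q" "\<not> 5 dvd coeff_sum q" "[coeff_sum p = r * coeff_sum q] (mod 5)"
    "g = Fract p' q'" "\<not> 5 dvd coeff_sum q'" "[coeff_sum p' = s * coeff_sum q'] (mod 5)"
    unfolding reduces_to_def by blast
  have "[coeff_sum p * coeff_sum q' + coeff_sum p' * coeff_sum q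
        = r * coeff_sum q * coeff_sum q' + s * coeff_sum q' * coeff_sum q] (mod 5)"
    by (intro cong_add cong_mult *(3,6) cong_refl)
  with * show ?thesis unfolding reduces_to_def
    by (intro exI[of _ "p * q' + p' * q"] exI[of _ "q * q'"])
      (auto simp: prime_dvd_5 algebra_simps coeff_sum_nonzero)
qed

lemma reduces_to_uminus:
  assumes "reduces_to f r"
  shows "reduces_to (- f) (- r)"
proof -
  from assms obtain p q where *:
    "f = Fract p q" "\<not> 5 dvd coeff_sum q" "[coeff_sum p = r * coeff_sum q] (mod 5)"
    unfolding reduces_to_def by blast
  have "[- coeff_sum p = - r * coeff_sum q] (mod 5)"
    using *(3) by (simp add: cong_minus_minus_iff)
  with * show ?thesis unfolding reduces_to_def
    by (intro exI[of _ "- p"] exI[of _ q]) auto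
qed

lemma reduces_to_inverse:
  assumes "reduces_to f 1"
  shows "reduces_to (inverse f) 1"
proof -
  from assms obtain p q where *:
    "f = Fract p q" "\<not> 5 dvd coeff_sum q" "[coeff_sum p = coeff_sum q] (mod 5)"
    unfolding reduces_to_def by auto
  then have "\<not> 5 dvd coeff_sum p" by (simp add: cong_dvd_iff)
  with * show ?thesis unfolding reduces_to_def
    by (intro exI[of _ q] exI[of _ p]) (auto intro: cong_sym)
qed

lemma reduces_to_cong:
  assumes "reduces_to f r" "[r = s] (mod 5)"
  shows "reduces_to f s"
proof -
  have "[r * c = s * c] (mod 5)" for c
    using assms(2) by (intro cong_mult cong_refl)
  with assms(1) show ?thesis unfolding reduces_to_def using cong_trans by blast
qed

lemma reduces_to_1_nonzero:
  assumes "reduces_to f 1"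
  shows "f \<noteq> 0"
proof
  assume "f = 0"
  obtain p q where *:
    "f = Fract p q" "\<not> 5 dvd coeff_sum q" "[coeff_sum p = coeff_sum q] (mod 5)"
    using assms unfolding reduces_to_def by auto
  have "p = 0"
    using * \<open>f = 0\<close> coeff_sum_nonzero[OF *(2)] by (simp add: Zero_fract_def eq_fract)
  with * have "[coeff_sum q = 0] (mod 5)" by (simp add: cong_sym_eq)
  with * show False by (simp add: cong_0_iff)
qed

lemma rvar_nonzero: "rvar v \<noteq> 0"
  by (rule reduces_to_1_nonzero[OF reduces_to_rvar])

lemma iterate_reduces_to: "reduces_to (iterate n) 1"
proof (induction n rule: less_induct)
  case (less n)
  show ?case
  proof (cases "n \<le> 6")
    case True
    then show ?thesis by (simp add: iterate.simps[of n] init_val_def reduces_to_rvar)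
  next
    case False
    have IH: "reduces_to (iterate (n - k)) 1" if "k \<in> {1..6}" for k
      using less[of "n - k"] False that by simp
    note par = parA_def parB_def parC_def parD_def
    have num: "reduces_to (- ((parA * iterate (n - 5) * iterate (n - 1)
                + (parB + parC) * iterate (n - 4) * iterate (n - 2)) * iterate (n - 3)
              + parD * (iterate (n - 6) * iterate (n - 2) * iterate (n - 1))))
        (- ((1 * 1 * 1 + (1 + 1) * 1 * 1) * 1 + 1 * (1 * 1 * 1)))"
      unfolding par
      by (intro reduces_to_uminus reduces_to_add reduces_to_mult reduces_to_rvar IH) auto
    have "reduces_to (parD * iterate (n - 5) * iterate (n - 4)) (1 * 1 * 1)"
      unfolding par by (intro reduces_to_mult reduces_to_rvar IH) auto
    then have "reduces_to (inverse (parD * iterate (n - 5) * iterate (n - 4))) 1"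
      by (intro reduces_to_inverse) simp
    from reduces_to_mult[OF num this] have "reduces_to (iterate n) (- 4)"
      using False by (simp add: iterate.simps[of n] divide_inverse)
    then show ?thesis by (rule reduces_to_cong) (simp add: cong_def)
  qed
qed

lemma iterate_nonzero: "iterate n \<noteq> 0"
  by (rule reduces_to_1_nonzero[OF iterate_reduces_to])

lemma iterate_initial:
  "iterate 1 = rvar X1" "iterate 2 = rvar X2" "iterate 3 = rvar X3"
  "iterate 4 = rvar X4" "iterate 5 = rvar X5" "iterate 6 = rvar X6"
  by (subst iterate.simps; simp add: init_val_def)+

lemma iterate_step:
  assumes "n \<ge> 1"
  shows "iterate (n + 6) =
    - ((parA * iterate (n + 1) * iterate (n + 5)
          + (parB + parC) * iterate (n + 2) * iterate (n + 4)) * iterate (n + 3)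
        + parD * (iterate n * iterate (n + 4) * iterate (n + 5)))
    / (parD * iterate (n + 1) * iterate (n + 2))"
proof -
  have "n + 6 - 5 = n + 1" "n + 6 - 1 = n + 5" "n + 6 - 4 = n + 2"
    "n + 6 - 2 = n + 4" "n + 6 - 3 = n + 3" "n + 6 - 6 = n" "\<not> n + 6 \<le> 6"
    using assms by simp_all
  then show ?thesis by (simp only: iterate.simps[of "n + 6"] if_False)
qed

lemma recurrence_solve:
  fixes A B C D y0 y1 y2 y3 y4 y5 y6 :: "'a::field"
  assumes "D \<noteq> 0" "y1 \<noteq> 0" "y2 \<noteq> 0"
  shows "(A * y1 * y5 + (B + C) * y2 * y4) * y3 + D * (y0 * y4 * y5 + y1 * y2 * y6) = 0
    \<longleftrightarrow> y6 = - ((A * y1 * y5 + (B + C) * y2 * y4) * y3 + D * (y0 * y4 * y5)) / (D * y1 * y2)"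
    (is "?L = 0 \<longleftrightarrow> y6 = - ?N / ?den")
proof -
  have "?L = ?N + y6 * ?den" by (simp add: algebra_simps)
  moreover have "?den \<noteq> 0" using assms by simp
  ultimately show ?thesis
    by (metis add.commute eq_neg_iff_add_eq_0 nonzero_eq_divide_eq)
qed

theorem iterate_recurrence:
  assumes "n \<ge> 1"
  shows "(parA * iterate (n + 1) * iterate (n + 5)
            + (parB + parC) * iterate (n + 2) * iterate (n + 4)) * iterate (n + 3)
          + parD * (iterate n * iterate (n + 4) * iterate (n + 5)
                    + iterate (n + 1) * iterate (n + 2) * iterate (n + 6)) = 0"
proof -
  have "parD \<noteq> 0" by (simp add: parD_def rvar_nonzero)
  from iffD2[OF recurrence_solve[OF this iterate_nonzero iterate_nonzero] iterate_step[OF assms]]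
  show ?thesis .
qed

theorem iterate_unique:
  fixes x :: "nat \<Rightarrow> ratfun"
  assumes init: "x 1 = rvar X1" "x 2 = rvar X2" "x 3 = rvar X3"
      "x 4 = rvar X4" "x 5 = rvar X5" "x 6 = rvar X6"
    and rec: "\<And>n. n \<ge> 1 \<Longrightarrow>
      (parA * x (n + 1) * x (n + 5) + (parB + parC) * x (n + 2) * x (n + 4)) * x (n + 3)
        + parD * (x n * x (n + 4) * x (n + 5) + x (n + 1) * x (n + 2) * x (n + 6)) = 0"
    and "n \<ge> 1"
  shows "x n = iterate n"
  using \<open>n \<ge> 1\<close>
proof (induction n rule: less_induct)
  case (less n)
  show ?case
  proof (cases "n \<le> 6")
    case True
    with less.prems have "n \<in> {1, 2, 3, 4, 5, 6}" by auto
    then show ?thesis using init iterate_initial by auto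
  next
    case False
    define m where "m = n - 6"
    have m: "m \<ge> 1" "n = m + 6" using False by (auto simp: m_def)
    have IH: "x m = iterate m" "x (m + 1) = iterate (m + 1)" "x (m + 2) = iterate (m + 2)"
      "x (m + 3) = iterate (m + 3)" "x (m + 4) = iterate (m + 4)" "x (m + 5) = iterate (m + 5)"
      using m by (auto intro!: less.IH)
    have "parD \<noteq> 0" by (simp add: parD_def rvar_nonzero)
    from rec[OF m(1), unfolded IH recurrence_solve[OF this iterate_nonzero iterate_nonzero]]
    show ?thesis unfolding m(2) iterate_step[OF m(1)] .
  qed
qed

end

theory Submission
  imports Defs
begin

text \<open>
  Write \<open>y\<^sub>n = x\<^sub>n\<^sub>+\<^sub>1\<close>, \<open>a = A/D\<close>, \<open>b = (B + C)/D\<close>, and consider an arbitrary orbit without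
  zeros in an arbitrary field. Let \<open>L\<close> be the ring generated by \<open>a\<close>, \<open>b\<close>, \<open>y\<^sub>0, \<dots>, y\<^sub>5\<close> and their
  inverses. Direct computation gives \<open>y\<^sub>6, \<dots>, y\<^sub>1\<^sub>2 \<in> L\<close> and shows that each of \<open>y\<^sub>7, \<dots>, y\<^sub>1\<^sub>2\<close> is
  congruent modulo \<open>y\<^sub>6\<close> to a monomial, that is, to a unit of \<open>L\<close>. By induction over all orbits at
  once, \<open>y\<^sub>n\<close> lies in the Laurent rings of the windows starting at \<open>y\<^sub>1\<close> and at \<open>y\<^sub>7\<close>; hence both a
  power of \<open>y\<^sub>6\<close> and a power of \<open>y\<^sub>7 \<cdots> y\<^sub>1\<^sub>2\<close> multiply \<open>y\<^sub>n\<close> into \<open>L\<close>. As these are comaximal,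
  \<open>y\<^sub>n \<in> L\<close>.

  For indeterminate parameters it remains to remove \<open>A\<close> and \<open>B + C\<close> from the denominator. At
  \<open>A = B = C = 0\<close> the recurrence is monomial, so \<open>x\<^sub>n\<close> has a representation \<open>p/q\<close> with \<open>q\<close> not
  vanishing there. As \<open>A\<close> and \<open>B + C\<close> are prime and do not divide \<open>q\<close>, they cancel.
\<close>

section \<open>Laurent rings of orbits over a field\<close>

lemma ring_adjoin_0: "0 \<in> ring_adjoin S"
  using ring_adjoin.diff[OF ring_adjoin.one ring_adjoin.one] by simp

lemma ring_adjoin_uminus: "f \<in> ring_adjoin S \<Longrightarrow> - f \<in> ring_adjoin S"
  using ring_adjoin.diff[OF ring_adjoin_0, of f] by simp

lemma ring_adjoin_add:
  "f \<in> ring_adjoin S \<Longrightarrow> g \<in> ring_adjoin S \<Longrightarrow> f + g \<in> ring_adjoin S"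
  using ring_adjoin.diff[OF _ ring_adjoin_uminus, of f S g] by simp

lemma ring_adjoin_power: "f \<in> ring_adjoin S \<Longrightarrow> f ^ k \<in> ring_adjoin S"
  by (induction k) (auto intro: ring_adjoin.one ring_adjoin.mult)

lemmas ring_adjoin_closed = ring_adjoin_uminus ring_adjoin_add ring_adjoin.diff ring_adjoin.mult
  ring_adjoin_power

text \<open>The elements that some power of \<open>s\<close> carries into
  \<open>ring_adjoin S\<close> form a subring, since exponents add up; hence it suffices to look at
  the generators in \<open>T\<close>.\<close>

lemma ring_adjoin_localise:
  assumes s: "s \<in> ring_adjoin S"
    and gens: "\<And>g. g \<in> T \<Longrightarrow> \<exists>k. s ^ k * g \<in> ring_adjoin S"
    and "f \<in> ring_adjoin T"
  shows "\<exists>k. s ^ k * f \<in> ring_adjoin S"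
  using assms(3)
proof induction
  case one
  then show ?case by (intro exI[of _ 0]) (simp add: ring_adjoin.one)
next
  case (gen g)
  then show ?case by (rule gens)
next
  case (diff f g)
  then obtain k l where *: "s ^ k * f \<in> ring_adjoin S" "s ^ l * g \<in> ring_adjoin S" by blast
  have "s ^ l * (s ^ k * f) - s ^ k * (s ^ l * g) \<in> ring_adjoin S"
    by (intro * s ring_adjoin_closed)
  moreover have "s ^ l * (s ^ k * f) - s ^ k * (s ^ l * g) = s ^ (k + l) * (f - g)"
    by (simp add: power_add algebra_simps)
  ultimately show ?case by metis
next
  case (mult f g)
  then obtain k l where *: "s ^ k * f \<in> ring_adjoin S" "s ^ l * g \<in> ring_adjoin S" by blast
  have "(s ^ k * f) * (s ^ l * g) \<in> ring_adjoin S" by (intro ring_adjoin.mult *)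
  moreover have "(s ^ k * f) * (s ^ l * g) = s ^ (k + l) * (f * g)"
    by (simp add: power_add mult_ac)
  ultimately show ?case by metis
qed

text \<open>For exponents 1 this is \<open>g = u * (s * g) + v * (t * g)\<close>. Lowering the
  exponents one at a time reduces to that case and avoids a Bezout identity for powers.\<close>

lemma ring_adjoin_comaximal:
  assumes L: "s \<in> ring_adjoin S" "t \<in> ring_adjoin S" "u \<in> ring_adjoin S" "v \<in> ring_adjoin S"
    and bezout: "u * s + v * t = 1"
    and s: "s ^ k * f \<in> ring_adjoin S" and t: "t ^ l * f \<in> ring_adjoin S"
  shows "f \<in> ring_adjoin S"
proof -
  have base: "g \<in> ring_adjoin S" if "s * g \<in> ring_adjoin S" "t * g \<in> ring_adjoin S" for g
  proof -
    have "u * (s * g) + v * (t * g) = (u * s + v * t) * g" by (simp add: algebra_simps)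
    also have "\<dots> = g" by (simp add: bezout)
    finally show ?thesis
      using ring_adjoin_add[OF ring_adjoin.mult[OF L(3) that(1)] ring_adjoin.mult[OF L(4) that(2)]]
      by simp
  qed
  have step: "s ^ k * g \<in> ring_adjoin S \<Longrightarrow> t * g \<in> ring_adjoin S \<Longrightarrow> g \<in> ring_adjoin S" for k g
  proof (induction k)
    case (Suc k)
    have "s ^ k * (t * g) \<in> ring_adjoin S"
      by (intro Suc.prems L ring_adjoin_closed)
    then have "t * (s ^ k * g) \<in> ring_adjoin S" by (metis mult.left_commute)
    moreover have "s * (s ^ k * g) \<in> ring_adjoin S" using Suc.prems(1) by (simp add: mult.assoc)
    ultimately have "s ^ k * g \<in> ring_adjoin S" by (rule base[rotated])
    with Suc show ?case by blast
  qed simp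
  show ?thesis using t
  proof (induction l)
    case (Suc l)
    have "t ^ l * (s ^ k * f) \<in> ring_adjoin S" by (intro ring_adjoin.mult ring_adjoin_power L s)
    then have "s ^ k * (t ^ l * f) \<in> ring_adjoin S" by (metis mult.left_commute)
    moreover have "t * (t ^ l * f) \<in> ring_adjoin S" using Suc.prems by (simp add: mult.assoc)
    ultimately have "t ^ l * f \<in> ring_adjoin S" by (rule step)
    then show ?case by (rule Suc.IH)
  qed simp
qed

section \<open>Orbits and their Laurent rings\<close>

lemma linear_solve:
  fixes c p q z :: "'a::field"
  assumes "p \<noteq> 0" "q \<noteq> 0" "c + p * q * z = 0"
  shows "z = - c * inverse p * inverse q"
proof -
  have "- c = p * q * z" using assms(3) by (simp add: neg_eq_iff_add_eq_0)
  then show ?thesis using assms(1,2) by (simp add: field_simps)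
qed

text \<open>The inverses of \<open>a\<close> and \<open>b\<close> are adjoined so that the monomials
  found modulo \<open>y 6\<close> become units. Later windows are obtained by passing a shifted
  \<open>y\<close>.\<close>

definition laurent_ring :: "'a::field \<Rightarrow> 'a \<Rightarrow> (nat \<Rightarrow> 'a) \<Rightarrow> 'a set" where
  "laurent_ring a b y = ring_adjoin
    ({a, b, inverse a, inverse b} \<union> y ` {..<6} \<union> (\<lambda>i. inverse (y i)) ` {..<6})"

locale orbit =
  fixes a b :: "'a::field" and y :: "nat \<Rightarrow> 'a"
  assumes a: "a \<noteq> 0" and b: "b \<noteq> 0" and y: "y n \<noteq> 0"
    and rec: "a * y (n + 1) * y (n + 3) * y (n + 5) + b * y (n + 2) * y (n + 3) * y (n + 4)
      + y n * y (n + 4) * y (n + 5) + y (n + 1) * y (n + 2) * y (n + 6) = 0"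
begin

abbreviation "L \<equiv> laurent_ring a b y"

text \<open>Transports facts about the first window to later ones, both for single terms as in
  \<open>mem_11\<close> and in the induction of \<open>orbit_laurent\<close>.\<close>

lemma shift: "orbit a b (\<lambda>n. y (n + k))"
proof
  fix n
  show "a * y (n + 1 + k) * y (n + 3 + k) * y (n + 5 + k)
      + b * y (n + 2 + k) * y (n + 3 + k) * y (n + 4 + k)
      + y (n + k) * y (n + 4 + k) * y (n + 5 + k) + y (n + 1 + k) * y (n + 2 + k) * y (n + 6 + k) = 0"
    using rec[of "n + k"] by (simp add: add_ac)
qed (use a b y in auto)

text \<open>Written with inverses instead of a quotient, the right-hand side is open to the closure
  rules of \<open>L\<close> and of \<open>cong6\<close>.\<close>

lemma solve:
  "y (n + 6) = - (a * y (n + 1) * y (n + 3) * y (n + 5) + b * y (n + 2) * y (n + 3) * y (n + 4)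
      + y n * y (n + 4) * y (n + 5)) * inverse (y (n + 1)) * inverse (y (n + 2))"
  by (rule linear_solve[OF y y rec])

lemma param_mem: "a \<in> L" "b \<in> L" "inverse a \<in> L" "inverse b \<in> L"
  unfolding laurent_ring_def by (rule ring_adjoin.gen, simp)+

lemma init_mem: "i < 6 \<Longrightarrow> y i \<in> L" "i < 6 \<Longrightarrow> inverse (y i) \<in> L"
  unfolding laurent_ring_def by (rule ring_adjoin.gen, simp)+

lemma closed:
  "f \<in> L \<Longrightarrow> - f \<in> L" "f \<in> L \<Longrightarrow> g \<in> L \<Longrightarrow> f + g \<in> L"
  "f \<in> L \<Longrightarrow> g \<in> L \<Longrightarrow> f - g \<in> L" "f \<in> L \<Longrightarrow> g \<in> L \<Longrightarrow> f * g \<in> L"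
  "f \<in> L \<Longrightarrow> f ^ k \<in> L"
  unfolding laurent_ring_def by (rule ring_adjoin_closed; assumption)+

section \<open>Congruence modulo \<open>y 6\<close> and units of the Laurent ring\<close>

definition cong6 :: "'a \<Rightarrow> 'a \<Rightarrow> bool" where
  "cong6 f g \<longleftrightarrow> f \<in> L \<and> g \<in> L \<and> (\<exists>h\<in>L. f - g = y 6 * h)"

lemma one_mem: "1 \<in> L" and zero_mem: "0 \<in> L"
  unfolding laurent_ring_def by (rule ring_adjoin.one, rule ring_adjoin_0)

lemma cong6_refl: "f \<in> L \<Longrightarrow> cong6 f f"
  unfolding cong6_def by (auto intro: bexI[of _ 0] zero_mem)

lemma cong6I: "f \<in> L \<Longrightarrow> g \<in> L \<Longrightarrow> h \<in> L \<Longrightarrow> f - g = y 6 * h \<Longrightarrow> cong6 f g"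
  unfolding cong6_def by blast

lemma cong6E:
  assumes "cong6 f g"
  obtains h where "f \<in> L" "g \<in> L" "h \<in> L" "f = g + y 6 * h"
  using assms unfolding cong6_def by (metis add.commute diff_add_cancel)

lemma cong6_uminus:
  assumes "cong6 f g"
  shows "cong6 (- f) (- g)"
  using assms
proof (rule cong6E)
  fix h assume *: "f \<in> L" "g \<in> L" "h \<in> L" "f = g + y 6 * h"
  show ?thesis by (rule cong6I[OF closed(1)[OF *(1)] closed(1)[OF *(2)] closed(1)[OF *(3)]])
      (simp add: *(4))
qed

lemma cong6_sym:
  assumes "cong6 f g"
  shows "cong6 g f"
  using assms
proof (rule cong6E)
  fix h assume *: "f \<in> L" "g \<in> L" "h \<in> L" "f = g + y 6 * h"
  show ?thesis by (rule cong6I[OF *(2,1) closed(1)[OF *(3)]]) (simp add: *(4))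
qed

lemma cong6_add:
  assumes "cong6 f g" "cong6 f' g'"
  shows "cong6 (f + f') (g + g')"
  using assms(1)
proof (rule cong6E)
  fix h assume *: "f \<in> L" "g \<in> L" "h \<in> L" "f = g + y 6 * h"
  obtain h' where **: "f' \<in> L" "g' \<in> L" "h' \<in> L" "f' = g' + y 6 * h'"
    using assms(2) by (rule cong6E)
  show ?thesis
    by (rule cong6I[OF closed(2)[OF *(1) **(1)] closed(2)[OF *(2) **(2)] closed(2)[OF *(3) **(3)]])
      (simp add: *(4) **(4) algebra_simps)
qed

lemma cong6_trans:
  assumes "cong6 f g" "cong6 g k"
  shows "cong6 f k"
  using assms(1)
proof (rule cong6E)
  fix h assume *: "f \<in> L" "g \<in> L" "h \<in> L" "f = g + y 6 * h"
  obtain h' where **: "g \<in> L" "k \<in> L" "h' \<in> L" "g = k + y 6 * h'"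
    using assms(2) by (rule cong6E)
  show ?thesis
    by (rule cong6I[OF *(1) **(2) closed(2)[OF *(3) **(3)]]) (simp add: *(4) **(4) algebra_simps)
qed

text \<open>The new cofactor is \<open>f * h' + h * g'\<close>; it lies in \<open>L\<close> because
  \<open>cong6\<close> records the membership of both sides.\<close>

lemma cong6_mult:
  assumes "cong6 f g" "cong6 f' g'"
  shows "cong6 (f * f') (g * g')"
proof -
  obtain h h' where *: "f \<in> L" "g \<in> L" "f' \<in> L" "g' \<in> L" "h \<in> L" "h' \<in> L"
    "f - g = y 6 * h" "f' - g' = y 6 * h'"
    using assms unfolding cong6_def by blast
  have "f * f' - g * g' = f * (f' - g') + (f - g) * g'" by (simp add: algebra_simps)
  also have "\<dots> = y 6 * (f * h' + h * g')" by (simp add: * algebra_simps)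
  finally show ?thesis by (rule cong6I[rotated -1]) (intro closed *)+
qed

text \<open>As \<open>inverse 0 = 0\<close>, the two memberships alone would admit 0.\<close>

definition unit :: "'a \<Rightarrow> bool" where "unit u \<longleftrightarrow> u \<noteq> 0 \<and> u \<in> L \<and> inverse u \<in> L"

lemma unit_atoms: "unit a" "unit b" "i < 6 \<Longrightarrow> unit (y i)" "i < 6 \<Longrightarrow> unit (inverse (y i))"
  by (auto simp: unit_def a b y intro: param_mem init_mem)

lemma unit_mult: "unit u \<Longrightarrow> unit v \<Longrightarrow> unit (u * v)"
  by (auto simp: unit_def intro: closed)

lemma unit_power: "unit u \<Longrightarrow> unit (u ^ k)"
  by (auto simp: unit_def power_inverse[symmetric] intro: closed)

lemma unit_uminus: "unit u \<Longrightarrow> unit (- u)"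
  by (auto simp: unit_def intro: closed)

lemmas unit_intros = unit_uminus unit_mult unit_power unit_atoms

lemma cong6_cancel:
  assumes "unit u" "cong6 (u * f) (u * g)" "f \<in> L" "g \<in> L"
  shows "cong6 f g"
proof -
  have "cong6 (inverse u * (u * f)) (inverse u * (u * g))"
    using assms(1) by (intro cong6_mult[OF cong6_refl assms(2)]) (simp add: unit_def)
  moreover have "inverse u * (u * h) = h" for h
    using assms(1) by (simp add: unit_def field_simps)
  ultimately show ?thesis by simp
qed

text \<open>Divide \<open>f = u + y 6 * h\<close> by \<open>u\<close>.\<close>

lemma cong6_unit_bezout:
  assumes "cong6 f u" "unit u"
  obtains v w where "v \<in> L" "w \<in> L" "v * f + w * y 6 = 1"
proof -
  obtain h where h: "h \<in> L" "f - u = y 6 * h" using assms(1) unfolding cong6_def by blast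
  have "inverse u * f + - (inverse u * h) * y 6 = inverse u * (f - y 6 * h)"
    by (simp add: algebra_simps)
  also have "\<dots> = inverse u * u" by (simp flip: h(2))
  also have "\<dots> = 1" using assms(2) by (simp add: unit_def)
  finally show ?thesis
    by (rule that[rotated -1]) (use h assms(2) in \<open>auto simp: unit_def intro: closed\<close>)
qed

section \<open>The recurrence at small indices\<close>

lemma solve_at:
  assumes "m1 = n + 1" "m2 = n + 2" "m3 = n + 3" "m4 = n + 4" "m5 = n + 5" "m6 = n + 6"
  shows "y m6 = - (a * y m1 * y m3 * y m5 + b * y m2 * y m3 * y m4 + y n * y m4 * y m5)
      * inverse (y m1) * inverse (y m2)"
  unfolding assms by (rule solve)

lemma rec_at:
  assumes "m1 = n + 1" "m2 = n + 2" "m3 = n + 3" "m4 = n + 4" "m5 = n + 5" "m6 = n + 6"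
  shows "a * y m1 * y m3 * y m5 + b * y m2 * y m3 * y m4 + y n * y m4 * y m5
      + y m1 * y m2 * y m6 = 0"
  unfolding assms by (rule rec)

lemma solve_small:
  "y 6 = - (a * y 1 * y 3 * y 5 + b * y 2 * y 3 * y 4 + y 0 * y 4 * y 5)
    * inverse (y 1) * inverse (y 2)"
  "y 7 = - (a * y 2 * y 4 * y 6 + b * y 3 * y 4 * y 5 + y 1 * y 5 * y 6)
    * inverse (y 2) * inverse (y 3)"
  "y 8 = - (a * y 3 * y 5 * y 7 + b * y 4 * y 5 * y 6 + y 2 * y 6 * y 7)
    * inverse (y 3) * inverse (y 4)"
  "y 9 = - (a * y 4 * y 6 * y 8 + b * y 5 * y 6 * y 7 + y 3 * y 7 * y 8)
    * inverse (y 4) * inverse (y 5)"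
  \<comment> \<open>All indices are read off the goal and then checked; instances of
    \<open>solve\<close> itself would contain sums such as \<open>1 + 6\<close>.\<close>
  by (rule solve_at; simp)+

lemma rec_small:
  "a * y 1 * y 3 * y 5 + b * y 2 * y 3 * y 4 + y 0 * y 4 * y 5 + y 1 * y 2 * y 6 = 0"
  "a * y 2 * y 4 * y 6 + b * y 3 * y 4 * y 5 + y 1 * y 5 * y 6 + y 2 * y 3 * y 7 = 0"
  "a * y 3 * y 5 * y 7 + b * y 4 * y 5 * y 6 + y 2 * y 6 * y 7 + y 3 * y 4 * y 8 = 0"
  "a * y 4 * y 6 * y 8 + b * y 5 * y 6 * y 7 + y 3 * y 7 * y 8 + y 4 * y 5 * y 9 = 0"
  "a * y 5 * y 7 * y 9 + b * y 6 * y 7 * y 8 + y 4 * y 8 * y 9 + y 5 * y 6 * y 10 = 0"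
  "a * y 6 * y 8 * y 10 + b * y 7 * y 8 * y 9 + y 5 * y 9 * y 10 + y 6 * y 7 * y 11 = 0"
  "a * y 7 * y 9 * y 11 + b * y 8 * y 9 * y 10 + y 6 * y 10 * y 11 + y 7 * y 8 * y 12 = 0"
  by (rule rec_at; simp)+

lemmas y_closed = closed init_mem param_mem

text \<open>Up to \<open>y 9\<close> the recurrence divides only by members of the initial
  window.\<close>

lemma mem_6_to_9: "y 6 \<in> L" "y 7 \<in> L" "y 8 \<in> L" "y 9 \<in> L"
proof -
  show y6: "y 6 \<in> L" by (subst solve_small(1)) (intro y_closed; simp)
  show y7: "y 7 \<in> L" by (subst solve_small(2)) (intro y_closed y6; simp)
  show y8: "y 8 \<in> L" by (subst solve_small(3)) (intro y_closed y6 y7; simp)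
  show "y 9 \<in> L" by (subst solve_small(4)) (intro y_closed y6 y7 y8; simp)
qed

lemma cong6_y6: "cong6 (y 6) 0"
  by (rule cong6I[of _ _ 1]) (simp_all add: mem_6_to_9 zero_mem one_mem)

text \<open>The recurrence divides \<open>y 10\<close> by \<open>y 5 * y 6\<close>; the factor \<open>y 6\<close> cancels.\<close>

lemma y10_eq_aux:
  "y 3 * y 3 * (b * y 7 * y 8 + y 5 * y 10) + y 6 * y 9 * (a * y 2 * y 4 + y 1 * y 5) = 0"
proof -
  \<comment> \<open>This combines the recurrences that produce \<open>y 10\<close>,
    \<open>y 8\<close> and \<open>y 7\<close>. The second removes the terms of the first without the
    factor \<open>y 6\<close>; the third removes what the second brings in besides.\<close>
  have "y 6 * (y 3 * y 3 * (b * y 7 * y 8 + y 5 * y 10) + y 6 * y 9 * (a * y 2 * y 4 + y 1 * y 5))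
    = y 3 * y 3 * (a * y 5 * y 7 * y 9 + b * y 6 * y 7 * y 8 + y 4 * y 8 * y 9 + y 5 * y 6 * y 10)
      - y 3 * y 9 * (a * y 3 * y 5 * y 7 + b * y 4 * y 5 * y 6 + y 2 * y 6 * y 7 + y 3 * y 4 * y 8)
      + y 6 * y 9 * (a * y 2 * y 4 * y 6 + b * y 3 * y 4 * y 5 + y 1 * y 5 * y 6 + y 2 * y 3 * y 7)"
    by (simp add: algebra_simps)
  then show ?thesis unfolding rec_small using y by simp
qed

lemma y10_eq:
  "y 10 = - (b * y 7 * y 8) * inverse (y 5)
    - y 6 * y 9 * (a * y 2 * y 4 + y 1 * y 5) * inverse (y 3) * inverse (y 3) * inverse (y 5)"
  (is "_ = ?r")
proof -
  have "y 10 - ?r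
    = (y 3 * y 3 * (b * y 7 * y 8 + y 5 * y 10) + y 6 * y 9 * (a * y 2 * y 4 + y 1 * y 5))
      * inverse (y 3) * inverse (y 3) * inverse (y 5)"
    using y[of 3] y[of 5] by (simp add: field_simps)
  then show ?thesis unfolding y10_eq_aux by simp
qed

lemma mem_10: "y 10 \<in> L"
  unfolding y10_eq by (intro y_closed mem_6_to_9; simp)

text \<open>The recurrence divides \<open>y 11\<close> by \<open>y 6 * y 7\<close>. Its two terms
  without \<open>y 6\<close> are replaced through \<open>y10_eq_aux\<close>, after which
  \<open>y 6\<close> cancels and only the divisor \<open>y 7\<close> is left.\<close>

lemma y11_eq:
  "y 7 * y 11 = - (a * y 8 * y 10)
    + y 9 * y 9 * (a * y 2 * y 4 + y 1 * y 5) * inverse (y 3) * inverse (y 3)"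
proof -
  have "y 6 * (y 3 * y 3 * (y 7 * y 11 + a * y 8 * y 10) - y 9 * y 9 * (a * y 2 * y 4 + y 1 * y 5))
    = y 3 * y 3 * (a * y 6 * y 8 * y 10 + b * y 7 * y 8 * y 9 + y 5 * y 9 * y 10 + y 6 * y 7 * y 11)
      - y 9 * (y 3 * y 3 * (b * y 7 * y 8 + y 5 * y 10) + y 6 * y 9 * (a * y 2 * y 4 + y 1 * y 5))"
    by (simp add: algebra_simps)
  then have "y 3 * y 3 * (y 7 * y 11 + a * y 8 * y 10) - y 9 * y 9 * (a * y 2 * y 4 + y 1 * y 5) = 0"
    (is "?d = 0")
    unfolding rec_small y10_eq_aux using y by simp
  moreover have "y 7 * y 11 - (- (a * y 8 * y 10)
      + y 9 * y 9 * (a * y 2 * y 4 + y 1 * y 5) * inverse (y 3) * inverse (y 3))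
    = ?d * inverse (y 3) * inverse (y 3)"
    using y[of 3] by (simp add: field_simps)
  ultimately show ?thesis by simp
qed

lemma y12_eq:
  "y 7 * y 8 * y 12 = - (a * y 7 * y 9 * y 11 + b * y 8 * y 9 * y 10 + y 6 * y 10 * y 11)"
  unfolding eq_neg_iff_add_eq_0 using rec_small(7) by (simp only: add_ac)

section \<open>Leading monomials modulo \<open>y 6\<close>\<close>

lemmas cong6_intros = cong6_uminus cong6_add cong6_mult

lemma cong6_atoms: "cong6 a a" "cong6 b b" "i < 6 \<Longrightarrow> cong6 (y i) (y i)"
  "i < 6 \<Longrightarrow> cong6 (inverse (y i)) (inverse (y i))"
  by (auto intro: cong6_refl y_closed)

text \<open>Two of the three terms in the numerator contain \<open>y 6\<close>, so a single monomial
  survives. The same holds for \<open>y 8\<close> and \<open>y 9\<close>.\<close>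

lemma cong6_y7: "cong6 (y 7) (- (b * y 4 * y 5 * inverse (y 2)))" (is "cong6 _ ?m7")
proof -
  have "cong6 (y 7) (- (a * y 2 * y 4 * 0 + b * y 3 * y 4 * y 5 + y 1 * y 5 * 0)
      * inverse (y 2) * inverse (y 3))" (is "cong6 _ ?r")
    by (subst solve_small(2)) (intro cong6_intros cong6_y6 cong6_atoms; simp)
  also have "?r = ?m7" using y by (simp add: field_simps)
  finally show ?thesis .
qed

lemma cong6_y8: "cong6 (y 8) (a * b * y 5 ^ 2 * inverse (y 2))" (is "cong6 _ ?m8")
proof -
  let ?m7 = "- (b * y 4 * y 5 * inverse (y 2))"
  have "cong6 (y 8) (- (a * y 3 * y 5 * ?m7 + b * y 4 * y 5 * 0 + y 2 * 0 * ?m7)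
      * inverse (y 3) * inverse (y 4))" (is "cong6 _ ?r")
    by (subst solve_small(3)) (intro cong6_intros cong6_y6 cong6_y7 cong6_atoms; simp)
  also have "?r = ?m8" using y by (simp add: field_simps power2_eq_square)
  finally show ?thesis .
qed

lemma cong6_y9: "cong6 (y 9) (a * b ^ 2 * y 3 * y 5 ^ 2 * inverse (y 2) ^ 2)" (is "cong6 _ ?m9")
proof -
  let ?m7 = "- (b * y 4 * y 5 * inverse (y 2))" and ?m8 = "a * b * y 5 ^ 2 * inverse (y 2)"
  have "cong6 (y 9) (- (a * y 4 * 0 * ?m8 + b * y 5 * 0 * ?m7 + y 3 * ?m7 * ?m8)
      * inverse (y 4) * inverse (y 5))" (is "cong6 _ ?r")
    by (subst solve_small(4)) (intro cong6_intros cong6_y6 cong6_y7 cong6_y8 cong6_atoms; simp)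
  also have "?r = ?m9" using y by (simp add: field_simps power2_eq_square)
  finally show ?thesis .
qed

lemma cong6_y10: "cong6 (y 10) (a * b ^ 3 * y 4 * y 5 ^ 2 * inverse (y 2) ^ 2)"
  (is "cong6 _ ?m10")
proof -
  let ?m7 = "- (b * y 4 * y 5 * inverse (y 2))" and ?m8 = "a * b * y 5 ^ 2 * inverse (y 2)"
  let ?m9 = "a * b ^ 2 * y 3 * y 5 ^ 2 * inverse (y 2) ^ 2"
  have "cong6 (y 10) (- (b * ?m7 * ?m8) * inverse (y 5)
      + - (0 * ?m9 * (a * y 2 * y 4 + y 1 * y 5) * inverse (y 3) * inverse (y 3) * inverse (y 5)))"
      (is "cong6 _ ?r")
    unfolding y10_eq diff_conv_add_uminus
    by (intro cong6_intros cong6_y6 cong6_y7 cong6_y8 cong6_y9 cong6_atoms; simp)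
  also have "?r = ?m10" using y by (simp add: field_simps power2_eq_square power3_eq_cube)
  finally show ?thesis .
qed

section \<open>Descent from later windows\<close>

lemma bezout_y6:
  assumes "cong6 f u" "unit u" "y 6 ^ k * g \<in> L" "f ^ l * g \<in> L"
  shows "g \<in> L"
proof -
  obtain v w where *: "v \<in> L" "w \<in> L" "v * f + w * y 6 = 1"
    using assms(1,2) by (rule cong6_unit_bezout)
  have f: "f \<in> L" using assms(1) unfolding cong6_def by blast
  show ?thesis unfolding laurent_ring_def
    by (rule ring_adjoin_comaximal[OF _ _ _ _ *(3)])
      (use * f mem_6_to_9(1) assms(3,4) in \<open>simp_all add: laurent_ring_def\<close>)
qed

text \<open>The window starting at \<open>y 1\<close> gains only \<open>y 6\<close>, which lies in
  \<open>L\<close>; so \<open>inverse (y 6)\<close> is the one generator that needs a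
  factor.\<close>

lemma next_window_localise:
  assumes "f \<in> laurent_ring a b (\<lambda>n. y (n + 1))"
  shows "\<exists>k. y 6 ^ k * f \<in> L"
  unfolding laurent_ring_def
proof (rule ring_adjoin_localise)
  show "y 6 \<in> ring_adjoin ({a, b, inverse a, inverse b} \<union> y ` {..<6} \<union> (\<lambda>i. inverse (y i)) ` {..<6})"
    using mem_6_to_9(1) by (simp add: laurent_ring_def)
  show "f \<in> ring_adjoin ({a, b, inverse a, inverse b} \<union> (\<lambda>i. y (i + 1)) ` {..<6}
      \<union> (\<lambda>i. inverse (y (i + 1))) ` {..<6})"
    using assms by (simp add: laurent_ring_def)
next
  fix g assume g: "g \<in> {a, b, inverse a, inverse b} \<union> (\<lambda>i. y (i + 1)) ` {..<6}
      \<union> (\<lambda>i. inverse (y (i + 1))) ` {..<6}"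
  have "y 6 ^ 0 * y (i + 1) \<in> L" if "i < 6" for i
    using that init_mem(1)[of "i + 1"] mem_6_to_9(1) by (cases "i = 5") auto
  moreover have "\<exists>k. y 6 ^ k * inverse (y (i + 1)) \<in> L" if "i < 6" for i
  proof (cases "i = 5")
    case True
    then show ?thesis using y[of 6] one_mem by (intro exI[of _ 1]) simp
  next
    case False
    then show ?thesis using that init_mem(2)[of "i + 1"] by (intro exI[of _ 0]) simp
  qed
  moreover have "y 6 ^ 0 * g \<in> L" if "g \<in> {a, b, inverse a, inverse b}"
    using that param_mem by auto
  ultimately show "\<exists>k. y 6 ^ k * g \<in> ring_adjoin
      ({a, b, inverse a, inverse b} \<union> y ` {..<6} \<union> (\<lambda>i. inverse (y i)) ` {..<6})"
    using g unfolding laurent_ring_def by blast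
qed

text \<open>As term 10 of the orbit shifted by one, \<open>y 11\<close> needs only a power of
  \<open>y 6\<close> as denominator; by \<open>y11_eq\<close> it also needs only \<open>y 7\<close>,
  which is a unit modulo \<open>y 6\<close>. The argument for \<open>y 12\<close> uses
  \<open>y 7 * y 8\<close> in the same way.\<close>

lemma mem_11: "y 11 \<in> L"
proof -
  have "y 11 \<in> laurent_ring a b (\<lambda>n. y (n + 1))"
    using orbit.mem_10[OF shift[of 1]] by simp
  then obtain k where k: "y 6 ^ k * y 11 \<in> L" using next_window_localise by blast
  have l: "y 7 ^ 1 * y 11 \<in> L"
    unfolding power_one_right y11_eq by (intro y_closed mem_6_to_9 mem_10; simp)
  show ?thesis
    by (rule bezout_y6[OF cong6_y7 _ k l]) (intro unit_intros; simp)
qed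

lemma cong6_y11:
  "cong6 (y 11) (- (a ^ 2 * b ^ 3 * y 1 * y 5 ^ 4 * inverse (y 2) ^ 3 * inverse (y 4)))"
  (is "cong6 _ ?m11")
proof -
  let ?m7 = "- (b * y 4 * y 5 * inverse (y 2))" and ?m8 = "a * b * y 5 ^ 2 * inverse (y 2)"
  let ?m9 = "a * b ^ 2 * y 3 * y 5 ^ 2 * inverse (y 2) ^ 2"
  let ?m10 = "a * b ^ 3 * y 4 * y 5 ^ 2 * inverse (y 2) ^ 2"
  have "cong6 (y 7 * y 11) (- (a * ?m8 * ?m10)
      + ?m9 * ?m9 * (a * y 2 * y 4 + y 1 * y 5) * inverse (y 3) * inverse (y 3))"
      (is "cong6 _ ?r")
    unfolding y11_eq
    by (intro cong6_intros cong6_y8 cong6_y9 cong6_y10 cong6_atoms; simp)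
  \<comment> \<open>The product \<open>a * ?m8 * ?m10\<close> cancels against the part with
    \<open>a * y 2 * y 4\<close>; the part with \<open>y 1 * y 5\<close> remains.\<close>
  also have "?r = ?m7 * ?m11"
    using y by (simp add: field_simps power2_eq_square power3_eq_cube power4_eq_xxxx)
  finally have "cong6 (y 7 * y 11) (?m7 * ?m11)" .
  \<comment> \<open>Only the monomial \<open>?m7\<close>, not \<open>y 7\<close> itself, is known to
    be a unit, so it is exchanged before cancelling.\<close>
  moreover have "cong6 (?m7 * y 11) (y 7 * y 11)"
    by (intro cong6_mult cong6_sym[OF cong6_y7] cong6_refl mem_11)
  ultimately have "cong6 (?m7 * y 11) (?m7 * ?m11)" by (rule cong6_trans[rotated])
  then show ?thesis
    by (rule cong6_cancel[rotated]) (intro unit_intros y_closed mem_11; simp)+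
qed

lemma mem_12: "y 12 \<in> L"
proof -
  have "y 12 \<in> laurent_ring a b (\<lambda>n. y (n + 1))"
    using orbit.mem_11[OF shift[of 1]] by simp
  then obtain k where k: "y 6 ^ k * y 12 \<in> L" using next_window_localise by blast
  have l: "(y 7 * y 8) ^ 1 * y 12 \<in> L"
    unfolding power_one_right y12_eq by (intro y_closed mem_6_to_9 mem_10 mem_11; simp)
  show ?thesis
    by (rule bezout_y6[OF cong6_mult[OF cong6_y7 cong6_y8] _ k l]) (intro unit_intros; simp)
qed

lemma cong6_y12:
  "cong6 (y 12) (- (a ^ 2 * b ^ 4 * y 0 * y 5 ^ 4 * inverse (y 2) ^ 4))"
  (is "cong6 _ ?m12")
proof -
  let ?m7 = "- (b * y 4 * y 5 * inverse (y 2))" and ?m8 = "a * b * y 5 ^ 2 * inverse (y 2)"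
  let ?m9 = "a * b ^ 2 * y 3 * y 5 ^ 2 * inverse (y 2) ^ 2"
  let ?m10 = "a * b ^ 3 * y 4 * y 5 ^ 2 * inverse (y 2) ^ 2"
  let ?m11 = "- (a ^ 2 * b ^ 3 * y 1 * y 5 ^ 4 * inverse (y 2) ^ 3 * inverse (y 4))"
  let ?c = "a ^ 3 * b ^ 6 * y 5 ^ 6 * inverse (y 2) ^ 6"
  have "cong6 (y 7 * y 8 * y 12) (- (a * ?m7 * ?m9 * ?m11 + b * ?m8 * ?m9 * ?m10 + 0 * ?m10 * ?m11))"
      (is "cong6 _ ?r")
    unfolding y12_eq
    by (intro cong6_intros cong6_y6 cong6_y7 cong6_y8 cong6_y9 cong6_y10 cong6_y11 cong6_atoms; simp)
  \<comment> \<open>Two terms survive here. Up to the factor \<open>?c\<close> they are the first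
    two terms of the recurrence for \<open>y 6\<close>, which turns them into a monomial plus a
    multiple of \<open>y 6\<close>.\<close>
  also have "?r = ?c * (y 0 * y 4 * y 5 + y 1 * y 2 * y 6)"
  proof -
    have *: "y 0 * y 4 * y 5 + y 1 * y 2 * y 6 = - (a * y 1 * y 3 * y 5 + b * y 2 * y 3 * y 4)"
      unfolding eq_neg_iff_add_eq_0 using rec_small(1) by (simp only: add_ac)
    show ?thesis unfolding * using y[of 2] y[of 4]
      by (simp add: field_simps power2_eq_square power3_eq_cube eval_nat_numeral)
  qed
  finally have "cong6 (y 7 * y 8 * y 12) (?c * (y 0 * y 4 * y 5 + y 1 * y 2 * y 6))" .
  moreover have "cong6 (?c * (y 0 * y 4 * y 5 + y 1 * y 2 * y 6)) (?c * (y 0 * y 4 * y 5 + y 1 * y 2 * 0))"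
    by (intro cong6_mult cong6_add cong6_y6 cong6_refl y_closed; simp)
  ultimately have "cong6 (y 7 * y 8 * y 12) (?c * (y 0 * y 4 * y 5 + y 1 * y 2 * 0))"
    by (rule cong6_trans)
  also have "?c * (y 0 * y 4 * y 5 + y 1 * y 2 * 0) = ?m7 * ?m8 * ?m12"
    using y[of 2] by (simp add: field_simps eval_nat_numeral)
  finally have "cong6 (y 7 * y 8 * y 12) (?m7 * ?m8 * ?m12)" .
  moreover have "cong6 (?m7 * ?m8 * y 12) (y 7 * y 8 * y 12)"
    by (intro cong6_mult cong6_sym[OF cong6_y7] cong6_sym[OF cong6_y8] cong6_refl mem_12)
  ultimately have "cong6 (?m7 * ?m8 * y 12) (?m7 * ?m8 * ?m12)" by (rule cong6_trans[rotated])
  then show ?thesis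
    by (rule cong6_cancel[rotated]) (intro unit_intros y_closed mem_12; simp)+
qed

text \<open>Since \<open>y 7\<close> to \<open>y 12\<close> lie in \<open>L\<close>, their product
  clears each of the six inverses.\<close>

lemma window_7_localise:
  assumes "f \<in> laurent_ring a b (\<lambda>n. y (n + 7))"
  shows "\<exists>k. (y 7 * y 8 * y 9 * y 10 * y 11 * y 12) ^ k * f \<in> L" (is "\<exists>k. ?M ^ k * f \<in> L")
proof -
  have M: "?M \<in> L" by (intro closed mem_6_to_9 mem_10 mem_11 mem_12)
  have gens: "\<exists>k. ?M ^ k * g \<in> L"
    if "g \<in> {a, b, inverse a, inverse b} \<union> (\<lambda>i. y (i + 7)) ` {..<6}
      \<union> (\<lambda>i. inverse (y (i + 7))) ` {..<6}" for g
  proof -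
    have i: "i \<in> {0, 1, 2, 3, 4, 5}" if "i < 6" for i :: nat using that by auto
    have "?M ^ 0 * y (i + 7) \<in> L" if "i < 6" for i
      using i[OF that] mem_6_to_9 mem_10 mem_11 mem_12 by auto
    moreover have "?M ^ 1 * inverse (y (i + 7)) \<in> L" if "i < 6" for i
    proof -
      have "?M * inverse (y (i + 7)) = (\<Prod>j\<in>{0, 1, 2, 3, 4, 5} - {i}. y (j + 7))"
        using i[OF that] y by (elim insertE emptyE) (simp_all add: insert_Diff_if mult_ac)
      moreover have "(\<Prod>j\<in>J. y (j + 7)) \<in> L" if "finite J" "J \<subseteq> {0, 1, 2, 3, 4, 5}" for J
        using that
      proof induction
        case (insert j J)
        then have "y (j + 7) \<in> L" using mem_6_to_9 mem_10 mem_11 mem_12 by auto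
        with insert show ?case by (simp add: closed)
      qed (simp add: one_mem)
      ultimately show ?thesis by simp
    qed
    moreover have "?M ^ 0 * g \<in> L" if "g \<in> {a, b, inverse a, inverse b}"
      using that param_mem by auto
    ultimately show ?thesis using that by blast
  qed
  show ?thesis
    using ring_adjoin_localise[OF M[unfolded laurent_ring_def] gens[unfolded laurent_ring_def]
      assms[unfolded laurent_ring_def]]
    unfolding laurent_ring_def by simp
qed

text \<open>The windows starting at \<open>y 1\<close> to \<open>y 6\<close> all contain
  \<open>y 6\<close>. The one at \<open>y 7\<close> is the first later window without it, and its
  denominators are units modulo \<open>y 6\<close>.\<close>

lemma mem_step:
  assumes "y n \<in> laurent_ring a b (\<lambda>n. y (n + 1))" "y n \<in> laurent_ring a b (\<lambda>n. y (n + 7))"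
  shows "y n \<in> L"
proof -
  obtain k l where k: "y 6 ^ k * y n \<in> L"
    and l: "(y 7 * y 8 * y 9 * y 10 * y 11 * y 12) ^ l * y n \<in> L"
    using next_window_localise[OF assms(1)] window_7_localise[OF assms(2)] by blast
  show ?thesis
    by (rule bezout_y6[OF _ _ k l],
        \<comment> \<open>The unit is left open and assembled from the six monomials.\<close>
        (rule cong6_mult cong6_y7 cong6_y8 cong6_y9 cong6_y10 cong6_y11 cong6_y12)+)
      (intro unit_intros; simp)
qed

end

theorem orbit_laurent:
  assumes "orbit a b y"
  shows "y n \<in> laurent_ring a b y"
  using assms
proof (induction n arbitrary: y rule: less_induct)
  case (less n)
  interpret orbit a b y by (rule less.prems)
  \<comment> \<open>\<open>y n\<close> is term \<open>n - k\<close> of the orbit shifted by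
    \<open>k\<close>. Shifting by 7 requires \<open>7 \<le> n\<close>, whence the case
    split.\<close>
  have IH: "y n \<in> laurent_ring a b (\<lambda>m. y (m + k))" if "0 < k" "k \<le> n" for k
    using less.IH[OF _ shift[of k], of "n - k"] that by simp
  show ?case
  proof (cases "n < 7")
    case True
    then show ?thesis using init_mem(1)[of n] mem_6_to_9(1) by (cases "n = 6") auto
  next
    case False
    then show ?thesis by (intro mem_step IH) auto
  qed
qed

section \<open>Evaluation and divisibility of polynomials\<close>

text \<open>Makes the product over all indeterminates in \<open>eval_mpoly\<close> a finite
  one.\<close>

instance indet :: finite
proof
  have "v \<in> {IndA, IndB, IndC, IndD, X1, X2, X3, X4, X5, X6}" for v by (cases v) auto
  then have "(UNIV :: indet set) \<subseteq> {IndA, IndB, IndC, IndD, X1, X2, X3, X4, X5, X6}" by blast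
  then show "finite (UNIV :: indet set)" by (rule finite_subset) simp
qed

definition eval_mpoly :: "(indet \<Rightarrow> 'a::comm_ring_1) \<Rightarrow> int_mpoly \<Rightarrow> 'a" where
  "eval_mpoly \<phi> p = (\<Sum>m\<in>Poly_Mapping.keys p.
    of_int (Poly_Mapping.lookup p m) * (\<Prod>v\<in>UNIV. \<phi> v ^ Poly_Mapping.lookup m v))"

lemma eval_mpoly_superset:
  assumes "finite M" "Poly_Mapping.keys p \<subseteq> M"
  shows "eval_mpoly \<phi> p = (\<Sum>m\<in>M.
    of_int (Poly_Mapping.lookup p m) * (\<Prod>v\<in>UNIV. \<phi> v ^ Poly_Mapping.lookup m v))"
  unfolding eval_mpoly_def
  by (rule sum.mono_neutral_left) (use assms in \<open>auto simp: in_keys_iff\<close>)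

lemma eval_mpoly_single:
  "eval_mpoly \<phi> (Poly_Mapping.single m c)
    = of_int c * (\<Prod>v\<in>UNIV. \<phi> v ^ Poly_Mapping.lookup m v)"
  by (subst eval_mpoly_superset[of "{m}"]) auto

lemma eval_mpoly_0 [simp]: "eval_mpoly \<phi> 0 = 0"
  by (simp add: eval_mpoly_def)

lemma eval_mpoly_1 [simp]: "eval_mpoly \<phi> 1 = 1"
  using eval_mpoly_single[of \<phi> 0 1] by simp

lemma eval_mpoly_mvar [simp]: "eval_mpoly \<phi> (mvar v) = \<phi> v"
proof -
  have "(\<Prod>u\<in>UNIV. \<phi> u ^ Poly_Mapping.lookup (Poly_Mapping.single v (1::nat)) u)
    = (\<Prod>u\<in>UNIV. if u = v then \<phi> u else 1)"
    by (intro prod.cong) (auto simp: lookup_single when_def)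
  then show ?thesis by (simp add: mvar_def eval_mpoly_single)
qed

lemma eval_mpoly_add [simp]: "eval_mpoly \<phi> (p + q) = eval_mpoly \<phi> p + eval_mpoly \<phi> q"
proof -
  let ?M = "Poly_Mapping.keys p \<union> Poly_Mapping.keys q"
  have "eval_mpoly \<phi> (p + q) = (\<Sum>m\<in>?M.
      of_int (Poly_Mapping.lookup (p + q) m) * (\<Prod>v\<in>UNIV. \<phi> v ^ Poly_Mapping.lookup m v))"
    by (rule eval_mpoly_superset) (auto simp: Poly_Mapping.keys_add)
  also have "\<dots> = eval_mpoly \<phi> p + eval_mpoly \<phi> q"
    by (simp add: lookup_add sum.distrib distrib_right eval_mpoly_superset[of ?M])
  finally show ?thesis .
qed

lemma eval_mpoly_uminus [simp]: "eval_mpoly \<phi> (- p) = - eval_mpoly \<phi> p"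
  using eval_mpoly_add[of \<phi> p "- p"] by (simp add: eq_neg_iff_add_eq_0 add.commute)

lemma eval_mpoly_mult [simp]: "eval_mpoly \<phi> (p * q) = eval_mpoly \<phi> p * eval_mpoly \<phi> q"
proof (induction p rule: mpoly_induct)
  case 1
  show ?case by simp
next
  case (2 m c p)
  have "eval_mpoly \<phi> (Poly_Mapping.single m c * q)
    = eval_mpoly \<phi> (Poly_Mapping.single m c) * eval_mpoly \<phi> q"
  proof (induction q rule: mpoly_induct)
    case 1
    show ?case by simp
  next
    case (2 m' c' q)
    have "eval_mpoly \<phi> (Poly_Mapping.single m c * Poly_Mapping.single m' c')
      = eval_mpoly \<phi> (Poly_Mapping.single m c) * eval_mpoly \<phi> (Poly_Mapping.single m' c')"
      by (simp add: mult_single eval_mpoly_single lookup_add power_add prod.distrib mult_ac)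
    with 2 show ?case by (simp only: distrib_left eval_mpoly_add)
  qed
  with 2 show ?case by (simp only: distrib_right eval_mpoly_add)
qed

lemma mvar_power: "mvar v ^ k = Poly_Mapping.single (Poly_Mapping.single v k) 1"
  by (induction k) (simp_all add: mvar_def mult_single flip: single_add)

lemma mpoly_single_eq:
  "Poly_Mapping.single m c = of_int c * (\<Prod>v\<in>UNIV. mvar v ^ Poly_Mapping.lookup m v)"
proof -
  have "(\<Prod>v\<in>V. mvar v ^ Poly_Mapping.lookup m v)
    = Poly_Mapping.single (\<Sum>v\<in>V. Poly_Mapping.single v (Poly_Mapping.lookup m v)) 1"
    if "finite V" for V
    using that by induction (simp_all add: mvar_power mult_single)
  moreover have "(\<Sum>v\<in>UNIV. Poly_Mapping.single v (Poly_Mapping.lookup m v)) = m"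
    by (rule poly_mapping_eqI) (simp add: lookup_sum lookup_single when_def)
  moreover have "(of_int c :: int_mpoly) = Poly_Mapping.single 0 c"
    by (simp flip: single_of_int)
  ultimately show ?thesis by (simp add: mult_single)
qed

lemma eval_mpoly_mvar_id: "eval_mpoly mvar p = p"
  by (induction p rule: mpoly_induct) (simp_all add: eval_mpoly_single flip: mpoly_single_eq)

section \<open>Cancelling prime factors by substitution\<close>

lemma dvd_mult_diff:
  fixes d :: "'a::comm_ring_1"
  assumes "d dvd f - g" "d dvd f' - g'"
  shows "d dvd f * f' - g * g'"
proof -
  have "f * f' - g * g' = f * (f' - g') + (f - g) * g'" by (simp add: algebra_simps)
  with assms show ?thesis by simp
qed

lemma dvd_power_diff:
  fixes d :: "'a::comm_ring_1"
  assumes "d dvd f - g"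
  shows "d dvd f ^ k - g ^ k"
  by (induction k) (simp_all add: dvd_mult_diff assms)

lemma dvd_prod_diff:
  fixes d :: "'a::comm_ring_1"
  assumes "\<And>v. d dvd f v - g v"
  shows "d dvd prod f V - prod g V"
  by (induction V rule: infinite_finite_induct) (simp_all add: dvd_mult_diff assms)

text \<open>Polynomials preserve congruences. With \<open>mvar\<close> for \<open>\<phi>\<close>
  this is a factor theorem: \<open>p\<close> differs from its image under the substitution
  \<open>\<psi>\<close> by a multiple of \<open>d\<close>.\<close>

lemma dvd_eval_mpoly_diff:
  assumes "\<And>v. d dvd \<phi> v - \<psi> v"
  shows "d dvd eval_mpoly \<phi> p - eval_mpoly \<psi> p"
  unfolding eval_mpoly_def sum_subtractf[symmetric] right_diff_distrib[symmetric]
  by (intro dvd_sum dvd_mult dvd_prod_diff dvd_power_diff assms)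

text \<open>The point lies on \<open>A = 0\<close> and on \<open>B + C = 0\<close>, so a polynomial
  not vanishing there is divisible by neither.\<close>

definition eval0 :: "int_mpoly \<Rightarrow> int" where
  "eval0 = eval_mpoly (\<lambda>v. of_bool (v \<notin> {IndA, IndB, IndC}))"

lemma eval0_simps [simp]:
  "eval0 0 = 0" "eval0 1 = 1" "eval0 (p + q) = eval0 p + eval0 q" "eval0 (- p) = - eval0 p"
  "eval0 (p * q) = eval0 p * eval0 q" "eval0 (mvar v) = of_bool (v \<notin> {IndA, IndB, IndC})"
  by (simp_all add: eval0_def)

text \<open>The multiples of \<open>d\<close> are exactly the kernel of the substitution
  \<open>\<phi>\<close>, whose values lie in an integral domain; so \<open>d\<close> behaves as a
  prime. It does not divide \<open>q\<close>, since \<open>eval0\<close> kills \<open>d\<close> but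
  not \<open>q\<close>.\<close>

lemma dvd_cancel_by_substitution:
  assumes \<phi>: "\<And>v. d dvd mvar v - \<phi> v" and d: "eval_mpoly \<phi> d = 0" "eval0 d = 0"
    and q: "eval0 q \<noteq> 0" and dvd: "d ^ k dvd h * q"
  shows "d ^ k dvd h"
  using dvd
proof (induction k arbitrary: h)
  case (Suc k)
  have dvdI: "d dvd p" if "eval_mpoly \<phi> p = 0" for p
    using dvd_eval_mpoly_diff[of d mvar \<phi> p, OF \<phi>] that by (simp add: eval_mpoly_mvar_id)
  have "d dvd h * q" using Suc.prems by (auto intro: dvd_mult_left)
  then obtain g where "h * q = d * g" by (rule dvdE)
  then have "eval_mpoly \<phi> (h * q) = eval_mpoly \<phi> (d * g)" by simp
  then have "eval_mpoly \<phi> h * eval_mpoly \<phi> q = 0" by (simp add: d(1))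
  then have "eval_mpoly \<phi> h = 0 \<or> eval_mpoly \<phi> q = 0" by simp
  moreover have "\<not> d dvd q"
  proof
    assume "d dvd q"
    then obtain r where "q = d * r" by (rule dvdE)
    then show False using d(2) q by simp
  qed
  ultimately have "d dvd h" using dvdI by blast
  then obtain r where r: "h = d * r" by (rule dvdE)
  show ?case
  proof (cases "d = 0")
    case True
    then show ?thesis by (simp add: r)
  next
    case False
    have "d * d ^ k dvd d * (r * q)" using Suc.prems by (simp only: r mult.assoc power_Suc)
    then have "d ^ k dvd r * q" using False by (simp only: dvd_mult_cancel_left) simp
    then have "d ^ k dvd r" by (rule Suc.IH)
    then show ?thesis by (simp add: r)
  qed
qed simp

lemma mvar_A_power_dvd_cancel:
  assumes "eval0 q \<noteq> 0" "mvar IndA ^ k dvd h * q"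
  shows "mvar IndA ^ k dvd h"
  by (rule dvd_cancel_by_substitution[of _ "mvar(IndA := 0)", OF _ _ _ assms]) auto

lemma mvar_B_C_power_dvd_cancel:
  assumes "eval0 q \<noteq> 0" "(mvar IndB + mvar IndC) ^ k dvd h * q"
  shows "(mvar IndB + mvar IndC) ^ k dvd h"
  by (rule dvd_cancel_by_substitution[of _ "mvar(IndB := - mvar IndC)", OF _ _ _ assms]) auto

section \<open>Removing the parameters from the denominator\<close>

text \<open>
  Reduction modulo 2 at \<open>A = B = C = 0\<close>, with \<open>D\<close> and the initial values set to 1: the fraction
  \<open>f\<close> is defined there, with value \<open>r\<close>.
\<close>

definition parity :: "ratfun \<Rightarrow> bool \<Rightarrow> bool" where
  "parity f r \<longleftrightarrow> (\<exists>p q. f = Fract p q \<and> odd (eval0 q) \<and> (odd (eval0 p) \<longleftrightarrow> r))"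

lemma odd_eval0_nonzero: "odd (eval0 q) \<Longrightarrow> q \<noteq> 0"
  by auto

lemma parity_rvar: "v \<notin> {IndA, IndB, IndC} \<Longrightarrow> parity (rvar v) True"
  and parity_A: "parity parA False" and parity_BC: "parity (parB + parC) False"
proof -
  show "parity parA False" unfolding parity_def rvar_def parA_def
    by (intro exI[of _ "mvar IndA"] exI[of _ 1]) auto
  show "parity (parB + parC) False" unfolding parity_def rvar_def parB_def parC_def
    by (intro exI[of _ "mvar IndB + mvar IndC"] exI[of _ 1]) auto
  show "parity (rvar v) True" if "v \<notin> {IndA, IndB, IndC}"
    unfolding parity_def rvar_def by (intro exI[of _ "mvar v"] exI[of _ 1]) (use that in auto)
qed

text \<open>Truth values stand for the field with two elements: conjunction is the product,
  \<open>\<noteq>\<close> the sum.\<close>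

lemma parity_mult:
  assumes "parity f r" "parity g s"
  shows "parity (f * g) (r \<and> s)"
proof -
  from assms obtain p q p' q' where *:
    "f = Fract p q" "odd (eval0 q)" "odd (eval0 p) \<longleftrightarrow> r"
    "g = Fract p' q'" "odd (eval0 q')" "odd (eval0 p') \<longleftrightarrow> s"
    unfolding parity_def by blast
  then show ?thesis unfolding parity_def
    by (intro exI[of _ "p * p'"] exI[of _ "q * q'"]) auto
qed

lemma parity_add:
  assumes "parity f r" "parity g s"
  shows "parity (f + g) (r \<noteq> s)"
proof -
  from assms obtain p q p' q' where *:
    "f = Fract p q" "odd (eval0 q)" "odd (eval0 p) \<longleftrightarrow> r"
    "g = Fract p' q'" "odd (eval0 q')" "odd (eval0 p') \<longleftrightarrow> s"
    unfolding parity_def by blast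
  then show ?thesis unfolding parity_def
    by (intro exI[of _ "p * q' + p' * q"] exI[of _ "q * q'"]) (auto simp: odd_eval0_nonzero)
qed

lemma parity_uminus:
  assumes "parity f r"
  shows "parity (- f) r"
proof -
  from assms obtain p q where "f = Fract p q" "odd (eval0 q)" "odd (eval0 p) \<longleftrightarrow> r"
    unfolding parity_def by blast
  then show ?thesis unfolding parity_def
    by (intro exI[of _ "- p"] exI[of _ q]) auto
qed

lemma parity_inverse:
  assumes "parity f True"
  shows "parity (inverse f) True"
proof -
  from assms obtain p q where "f = Fract p q" "odd (eval0 q)" "odd (eval0 p)"
    unfolding parity_def by blast
  then show ?thesis unfolding parity_def
    by (intro exI[of _ q] exI[of _ p]) auto
qed

text \<open>With \<open>A\<close> and \<open>B + C\<close> vanishing, only the term with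
  \<open>D\<close> is left in the numerator. Modulo 2 its sign disappears, so the value 1 reproduces
  itself.\<close>

lemma parity_iterate: "parity (iterate n) True"
proof (induction n rule: less_induct)
  case (less n)
  show ?case
  proof (cases "n \<le> 6")
    case True
    then have "[X1, X2, X3, X4, X5, X6] ! (n - 1) \<in> set [X1, X2, X3, X4, X5, X6]"
      by (intro nth_mem) simp
    then show ?thesis using True
      by (auto simp: iterate.simps[of n] init_val_def intro!: parity_rvar)
  next
    case False
    have IH: "parity (iterate (n - k)) True" if "k \<in> {1..6}" for k
      using less[of "n - k"] False that by simp
    have D: "parity parD True" unfolding parD_def by (rule parity_rvar) simp
    have num: "parity (- ((parA * iterate (n - 5) * iterate (n - 1)
                + (parB + parC) * iterate (n - 4) * iterate (n - 2)) * iterate (n - 3)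
              + parD * (iterate (n - 6) * iterate (n - 2) * iterate (n - 1))))
        ((((False \<and> True) \<and> True) \<noteq> ((False \<and> True) \<and> True) \<and> True) \<noteq> (True \<and> (True \<and> True) \<and> True))"
      by (intro parity_uminus parity_A parity_BC D parity_add parity_mult IH) auto
    have "parity (parD * iterate (n - 5) * iterate (n - 4)) ((True \<and> True) \<and> True)"
      by (intro parity_mult D IH) auto
    then have "parity (inverse (parD * iterate (n - 5) * iterate (n - 4))) True"
      by (intro parity_inverse) simp
    from parity_mult[OF num this] show ?thesis
      using False by (simp add: iterate.simps[of n] divide_inverse)
  qed
qed

section \<open>Fractions with prescribed denominators\<close>

inductive_set monomials :: "int_mpoly set" where
  one: "1 \<in> monomials"
| mvar_mult: "v \<notin> {IndA, IndB, IndC} \<Longrightarrow> u \<in> monomials \<Longrightarrow> mvar v * u \<in> monomials"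

lemma monomials_mult: "u \<in> monomials \<Longrightarrow> w \<in> monomials \<Longrightarrow> u * w \<in> monomials"
  by (induction u rule: monomials.induct) (auto simp: mult.assoc intro: monomials.intros)

lemma mvar_nonzero [simp]: "mvar v \<noteq> 0"
  using coeff_sum_mvar[of v] by force

lemma mvar_B_C_nonzero [simp]: "mvar IndB + mvar IndC \<noteq> 0"
proof -
  have "coeff_sum (mvar IndB + mvar IndC) \<noteq> 0" by simp
  then show ?thesis by (metis coeff_sum_zero)
qed

lemma monomials_nonzero: "u \<in> monomials \<Longrightarrow> u \<noteq> 0"
  by (induction rule: monomials.induct) auto

text \<open>A multiplicative set containing all denominators of the generators of the Laurent ring,
  with the two factors still to be removed kept apart.\<close>

definition denominators :: "int_mpoly set" where
  "denominators = {mvar IndA ^ i * (mvar IndB + mvar IndC) ^ j * u |i j u. u \<in> monomials}"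

lemma denominatorsI:
  "u \<in> monomials \<Longrightarrow> mvar IndA ^ i * (mvar IndB + mvar IndC) ^ j * u \<in> denominators"
  unfolding denominators_def by blast

lemma denominators_mult:
  assumes "d \<in> denominators" "e \<in> denominators"
  shows "d * e \<in> denominators"
proof -
  obtain i j u i' j' u' where *: "d = mvar IndA ^ i * (mvar IndB + mvar IndC) ^ j * u"
    "e = mvar IndA ^ i' * (mvar IndB + mvar IndC) ^ j' * u'" "u \<in> monomials" "u' \<in> monomials"
    using assms unfolding denominators_def by blast
  have "d * e = mvar IndA ^ (i + i') * (mvar IndB + mvar IndC) ^ (j + j') * (u * u')"
    unfolding * power_add by (simp only: mult_ac)
  also have "\<dots> \<in> denominators" by (intro denominatorsI monomials_mult *(3,4))
  finally show ?thesis .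
qed

lemma denominators_nonzero: "d \<in> denominators \<Longrightarrow> d \<noteq> 0"
  unfolding denominators_def using monomials_nonzero by auto

lemma denominators_gens:
  "1 \<in> denominators" "mvar IndA \<in> denominators" "mvar IndB + mvar IndC \<in> denominators"
  "v \<notin> {IndA, IndB, IndC} \<Longrightarrow> mvar v \<in> denominators"
  using denominatorsI[OF monomials.one, of 0 0] denominatorsI[OF monomials.one, of 1 0]
    denominatorsI[OF monomials.one, of 0 1]
    denominatorsI[OF monomials.mvar_mult[OF _ monomials.one], of v 0 0]
  by simp_all

text \<open>Fractions over a multiplicatively closed set of nonzero denominators form a
  subring.\<close>

lemma ring_adjoin_denominator:
  assumes "\<And>g. g \<in> S \<Longrightarrow> \<exists>p. \<exists>d\<in>denominators. g = Fract p d" and "f \<in> ring_adjoin S"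
  shows "\<exists>p. \<exists>d\<in>denominators. f = Fract p d"
  using assms(2)
proof induction
  case one
  show ?case using denominators_gens(1) by (auto simp: One_fract_def)
next
  case (gen g)
  then show ?case by (rule assms(1))
next
  case (diff f g)
  then obtain p q d e where *: "d \<in> denominators" "e \<in> denominators" "f = Fract p d" "g = Fract q e"
    by blast
  then have "f - g = Fract (p * e - q * d) (d * e)" by (simp add: denominators_nonzero)
  then show ?case using * denominators_mult by blast
next
  case (mult f g)
  then obtain p q d e where *: "d \<in> denominators" "e \<in> denominators" "f = Fract p d" "g = Fract q e"
    by blast
  then have "f * g = Fract (p * q) (d * e)" by simp
  then show ?case using * denominators_mult by blast
qed

abbreviation "coeffA \<equiv> parA / parD"
abbreviation "coeffB \<equiv> (parB + parC) / parD"

lemma coeffA_eq: "coeffA = Fract (mvar IndA) (mvar IndD)" 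
  and coeffB_eq: "coeffB = Fract (mvar IndB + mvar IndC) (mvar IndD)"
  by (simp_all add: parA_def parB_def parC_def parD_def rvar_def)

lemma orbit_iterate: "orbit coeffA coeffB (\<lambda>n. iterate (n + 1))"
proof
  fix n
  have D: "parD \<noteq> 0" by (simp add: parD_def rvar_nonzero)
  let ?x = "\<lambda>k. iterate (n + 1 + k)"
  have "coeffA * ?x 1 * ?x 3 * ?x 5 + coeffB * ?x 2 * ?x 3 * ?x 4 + ?x 0 * ?x 4 * ?x 5 + ?x 1 * ?x 2 * ?x 6
    = ((parA * ?x 1 * ?x 5 + (parB + parC) * ?x 2 * ?x 4) * ?x 3
      + parD * (?x 0 * ?x 4 * ?x 5 + ?x 1 * ?x 2 * ?x 6)) / parD"
    using D by (simp add: field_simps)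
  also have "\<dots> = 0" using iterate_recurrence[of "n + 1"] by simp
  finally show "coeffA * iterate (n + 1 + 1) * iterate (n + 3 + 1) * iterate (n + 5 + 1)
      + coeffB * iterate (n + 2 + 1) * iterate (n + 3 + 1) * iterate (n + 4 + 1)
      + iterate (n + 1) * iterate (n + 4 + 1) * iterate (n + 5 + 1)
      + iterate (n + 1 + 1) * iterate (n + 2 + 1) * iterate (n + 6 + 1) = 0"
    by (simp add: add_ac)
next
  show "coeffA \<noteq> 0" by (simp add: coeffA_eq Zero_fract_def eq_fract)
  show "coeffB \<noteq> 0" by (simp add: coeffB_eq Zero_fract_def eq_fract)
qed (rule iterate_nonzero)

lemma init_val_eq_rvar: "i < 6 \<Longrightarrow> \<exists>v. v \<notin> {IndA, IndB, IndC} \<and> iterate (i + 1) = rvar v"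
proof -
  assume i: "i < 6"
  then have "[X1, X2, X3, X4, X5, X6] ! i \<in> set [X1, X2, X3, X4, X5, X6]"
    by (intro nth_mem) simp
  then show ?thesis using i
    by (intro exI[of _ "[X1, X2, X3, X4, X5, X6] ! i"])
      (auto simp: iterate.simps[of "i + 1"] iterate.simps[of "Suc i"] init_val_def)
qed

lemma iterate_denominator: "\<exists>p. \<exists>d\<in>denominators. iterate (n + 1) = Fract p d"
proof (rule ring_adjoin_denominator)
  show "iterate (n + 1) \<in> ring_adjoin ({coeffA, coeffB, inverse coeffA, inverse coeffB}
    \<union> (\<lambda>i. iterate (i + 1)) ` {..<6} \<union> (\<lambda>i. inverse (iterate (i + 1))) ` {..<6})"
    using orbit_laurent[OF orbit_iterate, of n] by (simp add: laurent_ring_def)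
next
  fix g
  assume "g \<in> {coeffA, coeffB, inverse coeffA, inverse coeffB} \<union> (\<lambda>i. iterate (i + 1)) ` {..<6}
    \<union> (\<lambda>i. inverse (iterate (i + 1))) ` {..<6}"
  then consider "g \<in> {coeffA, coeffB, inverse coeffA, inverse coeffB}"
    | i where "i < 6" "g = iterate (i + 1)" | i where "i < 6" "g = inverse (iterate (i + 1))"
    by blast
  then show "\<exists>p. \<exists>d\<in>denominators. g = Fract p d"
  proof cases
    case 1
    then have "g \<in> {Fract (mvar IndA) (mvar IndD), Fract (mvar IndB + mvar IndC) (mvar IndD),
        Fract (mvar IndD) (mvar IndA), Fract (mvar IndD) (mvar IndB + mvar IndC)}"
      by (auto simp: coeffA_eq coeffB_eq)
    then show ?thesis using denominators_gens(2,3) denominators_gens(4)[of IndD] by blast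
  next
    case (2 i)
    then show ?thesis using init_val_eq_rvar[OF 2(1)] denominators_gens(1) by (auto simp: rvar_def)
  next
    case (3 i)
    then show ?thesis
      using init_val_eq_rvar[OF 3(1)] denominators_gens(4) by (fastforce simp: rvar_def)
  qed
qed

lemma iterate_monomial_denominator: "\<exists>p. \<exists>u\<in>monomials. iterate (n + 1) = Fract p u"
proof -
  obtain p i j u where u: "u \<in> monomials"
    and p: "iterate (n + 1) = Fract p (mvar IndA ^ i * (mvar IndB + mvar IndC) ^ j * u)"
    (is "_ = Fract p ?d")
    using iterate_denominator[of n] unfolding denominators_def by blast
  obtain r q where rq: "iterate (n + 1) = Fract r q" "odd (eval0 q)"
    using parity_iterate[of "n + 1"] unfolding parity_def by blast
  have q: "eval0 q \<noteq> 0" "q \<noteq> 0" using rq(2) by auto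
  have d: "?d \<noteq> 0" using monomials_nonzero[OF u] by auto
  have eq: "p * q = r * ?d" using p rq(1) d q(2) by (simp add: eq_fract)
  then have "mvar IndA ^ i dvd p * q" by simp
  then obtain p' where p': "p = mvar IndA ^ i * p'"
    using mvar_A_power_dvd_cancel[OF q(1)] by blast
  then have "mvar IndA ^ i * (p' * q) = mvar IndA ^ i * (r * ((mvar IndB + mvar IndC) ^ j * u))"
    using eq by (simp add: mult_ac)
  then have "p' * q = r * ((mvar IndB + mvar IndC) ^ j * u)" by simp
  then have "(mvar IndB + mvar IndC) ^ j dvd p' * q" by simp
  then obtain p'' where p'': "p' = (mvar IndB + mvar IndC) ^ j * p''"
    using mvar_B_C_power_dvd_cancel[OF q(1)] by blast
  have "iterate (n + 1) = Fract p'' u"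
    unfolding p using d monomials_nonzero[OF u] by (simp add: eq_fract p' p'' mult_ac)
  then show ?thesis using u by blast
qed

section \<open>Closure properties of Laurent polynomials\<close>

definition init_monomial :: "(nat \<Rightarrow> int) \<Rightarrow> ratfun" where
  "init_monomial e = (\<Prod>i=1..6. init_val i powi e i)"

lemma init_val_nonzero: "init_val i \<noteq> 0"
  by (simp add: init_val_def rvar_nonzero)

lemma init_monomial_0: "init_monomial (\<lambda>i. 0) = 1"
  by (simp add: init_monomial_def)

lemma init_monomial_add: "init_monomial (\<lambda>i. e i + d i) = init_monomial e * init_monomial d"
  by (simp add: init_monomial_def power_int_add init_val_nonzero prod.distrib)

lemma init_monomial_delta:
  assumes "k \<in> {1..6}"
  shows "init_monomial (\<lambda>i. if i = k then z else 0) = init_val k powi z"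
proof -
  have "init_monomial (\<lambda>i. if i = k then z else 0)
    = (\<Prod>i=1..6. if i = k then init_val i powi z else 1)"
    unfolding init_monomial_def by (intro prod.cong) auto
  then show ?thesis using assms by simp
qed

lemma laurent_polynomial_iff:
  "laurent_polynomial f \<longleftrightarrow>
    (\<exists>E c. finite E \<and> (\<forall>e\<in>E. c e \<in> coeff_ring) \<and> f = (\<Sum>e\<in>E. c e * init_monomial e))"
  unfolding laurent_polynomial_def init_monomial_def by blast

lemma coeff_ring_closed:
  "c \<in> coeff_ring \<Longrightarrow> d \<in> coeff_ring \<Longrightarrow> c * d \<in> coeff_ring"
  "c \<in> coeff_ring \<Longrightarrow> d \<in> coeff_ring \<Longrightarrow> c + d \<in> coeff_ring"
  "c \<in> coeff_ring \<Longrightarrow> - c \<in> coeff_ring"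
  "1 \<in> coeff_ring" "0 \<in> coeff_ring"
  unfolding coeff_ring_def
  by (auto intro: ring_adjoin.mult ring_adjoin_add ring_adjoin_uminus ring_adjoin.one ring_adjoin_0)

lemma coeff_ring_gens: "{parA, parB, parC, parD, inverse parD} \<subseteq> coeff_ring"
  unfolding coeff_ring_def by (auto intro: ring_adjoin.gen)

lemma laurent_polynomial_coeff:
  assumes "c \<in> coeff_ring"
  shows "laurent_polynomial c"
  unfolding laurent_polynomial_iff
  by (rule exI[of _ "{\<lambda>i. 0}"], rule exI[of _ "\<lambda>e. c"]) (simp add: assms init_monomial_0)

lemma laurent_polynomial_add:
  assumes "laurent_polynomial f" "laurent_polynomial g"
  shows "laurent_polynomial (f + g)"
proof -
  obtain E c E' c' where *: "finite E" "\<forall>e\<in>E. c e \<in> coeff_ring" "f = (\<Sum>e\<in>E. c e * init_monomial e)"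
    "finite E'" "\<forall>e\<in>E'. c' e \<in> coeff_ring" "g = (\<Sum>e\<in>E'. c' e * init_monomial e)"
    using assms unfolding laurent_polynomial_iff by blast
  \<comment> \<open>Nothing is known of \<open>c\<close> outside \<open>E\<close>, so it is cut off
    before both sums are extended to the union.\<close>
  define c1 where "c1 e = (if e \<in> E then c e else 0)" for e
  define c2 where "c2 e = (if e \<in> E' then c' e else 0)" for e
  have "f = (\<Sum>e\<in>E \<union> E'. c1 e * init_monomial e)"
    unfolding *(3) using *(1,4) by (intro sum.mono_neutral_cong_left) (auto simp: c1_def)
  moreover have "g = (\<Sum>e\<in>E \<union> E'. c2 e * init_monomial e)"
    unfolding *(6) using *(1,4) by (intro sum.mono_neutral_cong_left) (auto simp: c2_def)
  ultimately have "f + g = (\<Sum>e\<in>E \<union> E'. (c1 e + c2 e) * init_monomial e)"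
    by (simp add: sum.distrib distrib_right)
  moreover have "c1 e + c2 e \<in> coeff_ring" for e
    using *(2,5) by (intro coeff_ring_closed(2)) (auto simp: c1_def c2_def coeff_ring_closed)
  ultimately show ?thesis unfolding laurent_polynomial_iff using *(1,4)
    by (intro exI[of _ "E \<union> E'"] exI[of _ "\<lambda>e. c1 e + c2 e"]) auto
qed

lemma laurent_polynomial_mult_term:
  assumes "laurent_polynomial f" "d \<in> coeff_ring"
  shows "laurent_polynomial (d * init_monomial t * f)"
proof -
  obtain E c where *: "finite E" "\<forall>e\<in>E. c e \<in> coeff_ring" "f = (\<Sum>e\<in>E. c e * init_monomial e)"
    using assms(1) unfolding laurent_polynomial_iff by blast
  \<comment> \<open>Multiplication by a monomial translates the exponents; \<open>h'\<close>
    recovers the old exponent, at which the coefficient is to be read.\<close>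
  define h where "h e = (\<lambda>i. e i + t i)" for e :: "nat \<Rightarrow> int"
  define h' where "h' e = (\<lambda>i. e i - t i)" for e :: "nat \<Rightarrow> int"
  have h: "h' (h e) = e" for e by (simp add: h_def h'_def)
  then have inj: "inj_on h E" by (metis inj_onI)
  have "(\<Sum>e\<in>h ` E. d * c (h' e) * init_monomial e) = (\<Sum>e\<in>E. d * c e * init_monomial (h e))"
    by (simp add: sum.reindex[OF inj] h)
  also have "\<dots> = d * init_monomial t * f"
    unfolding h_def init_monomial_add *(3) by (simp add: sum_distrib_left mult_ac)
  finally show ?thesis unfolding laurent_polynomial_iff using * assms(2)
    by (intro exI[of _ "h ` E"] exI[of _ "\<lambda>e. d * c (h' e)"]) (auto simp: h coeff_ring_closed)
qed

lemma laurent_polynomial_mult_coeff: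
  "laurent_polynomial f \<Longrightarrow> d \<in> coeff_ring \<Longrightarrow> laurent_polynomial (d * f)"
  using laurent_polynomial_mult_term[of f d "\<lambda>i. 0"] by (simp add: init_monomial_0)

lemma laurent_polynomial_mult_init:
  "laurent_polynomial f \<Longrightarrow> k \<in> {1..6} \<Longrightarrow> laurent_polynomial (init_val k powi z * f)"
  using laurent_polynomial_mult_term[of f 1 "\<lambda>i. if i = k then z else 0"]
  by (simp add: init_monomial_delta coeff_ring_closed)

text \<open>Sorts the indeterminates by invertibility. The first case also records \<open>v\<close>,
  so that it can be excluded when inverses are taken.\<close>

lemma rvar_cases:
  "rvar v \<in> {parA, parB, parC} \<and> v \<in> {IndA, IndB, IndC} \<or> rvar v = parD
    \<or> (\<exists>k\<in>{1..6}. rvar v = init_val k)"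
proof (cases v)
  case X1
  then show ?thesis by (intro disjI2 bexI[of _ 1]) (auto simp: init_val_def)
next
  case X2
  then show ?thesis by (intro disjI2 bexI[of _ 2]) (auto simp: init_val_def)
next
  case X3
  then show ?thesis by (intro disjI2 bexI[of _ 3]) (auto simp: init_val_def)
next
  case X4
  then show ?thesis by (intro disjI2 bexI[of _ 4]) (auto simp: init_val_def eval_nat_numeral)
next
  case X5
  then show ?thesis by (intro disjI2 bexI[of _ 5]) (auto simp: init_val_def eval_nat_numeral)
next
  case X6
  then show ?thesis by (intro disjI2 bexI[of _ 6]) (auto simp: init_val_def eval_nat_numeral)
qed (auto simp: parA_def parB_def parC_def parD_def)

lemma laurent_polynomial_mult_rvar:
  assumes "laurent_polynomial f"
  shows "laurent_polynomial (rvar v * f)"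
  using rvar_cases[of v] coeff_ring_gens laurent_polynomial_mult_coeff[OF assms]
    laurent_polynomial_mult_init[OF assms, of _ 1] by auto

lemma laurent_polynomial_mult_inverse_rvar:
  assumes "laurent_polynomial f" "v \<notin> {IndA, IndB, IndC}"
  shows "laurent_polynomial (inverse (rvar v) * f)"
  using rvar_cases[of v] coeff_ring_gens laurent_polynomial_mult_coeff[OF assms(1)] assms(2)
    laurent_polynomial_mult_init[OF assms(1), of _ "- 1"] by (auto simp: power_int_minus)

text \<open>By \<open>mpoly_single_eq\<close> each term is an integer times powers of
  indeterminates; integers lie in \<open>coeff_ring\<close>, and the indeterminates are multiplied
  in one by one.\<close>

lemma laurent_polynomial_Fract_1: "laurent_polynomial (Fract p 1)"
proof (induction p rule: mpoly_induct)
  case 1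
  show ?case using laurent_polynomial_coeff[OF coeff_ring_closed(5)] by (simp add: Zero_fract_def)
next
  case (2 m c p)
  have "(of_nat k :: ratfun) \<in> coeff_ring" for k
    by (induction k) (auto intro: coeff_ring_closed)
  then have "(of_int c :: ratfun) \<in> coeff_ring"
    by (cases c rule: int_cases2) (auto intro: coeff_ring_closed)
  moreover have "Fract (of_nat k) 1 = (of_nat k :: ratfun)" for k
    by (simp add: of_nat_fract)
  then have "Fract (of_int c) 1 = (of_int c :: ratfun)"
    by (cases c rule: int_cases2) (auto simp flip: minus_fract)
  ultimately have const: "laurent_polynomial (Fract (of_int c) 1)"
    by (simp add: laurent_polynomial_coeff)
  have mult: "laurent_polynomial (Fract (mvar v ^ k * q) 1)" if "laurent_polynomial (Fract q 1)"
    for v k q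
    using that
  proof (induction k)
    case (Suc k)
    have "Fract (mvar v ^ Suc k * q) 1 = rvar v * Fract (mvar v ^ k * q) 1"
      by (simp add: rvar_def mult_ac)
    then show ?case using Suc by (simp add: laurent_polynomial_mult_rvar)
  qed simp
  have "laurent_polynomial (Fract ((\<Prod>v\<in>V. mvar v ^ k v) * of_int c) 1)" if "finite V" for V k
    using that by induction (simp_all add: const mult mult.assoc)
  then have "laurent_polynomial (Fract (Poly_Mapping.single m c) 1)"
    by (simp add: mpoly_single_eq mult.commute)
  from laurent_polynomial_add[OF this 2] show ?case by simp
qed

lemma laurent_polynomial_Fract_monomial:
  assumes "u \<in> monomials"
  shows "laurent_polynomial (Fract p u)"
  using assms
proof induction
  case one
  show ?case by (rule laurent_polynomial_Fract_1)
next
  case (mvar_mult v u)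
  have "Fract p (mvar v * u) = inverse (rvar v) * Fract p u" by (simp add: rvar_def)
  then show ?case using mvar_mult by (simp add: laurent_polynomial_mult_inverse_rvar)
qed

theorem proposition1:
  shows "\<forall>n\<ge>1. laurent_polynomial (iterate n)"
proof (intro allI impI)
  fix n :: nat
  assume "1 \<le> n"
  then obtain p u where "u \<in> monomials" "iterate n = Fract p u"
    using iterate_monomial_denominator[of "n - 1"] by auto
  then show "laurent_polynomial (iterate n)" by (simp add: laurent_polynomial_Fract_monomial)
qed

end
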